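(* Let $R$ be a Noetherian commutative ring of prime characteristic $p$. If $R$ has finite F-representation type (FFRT), then: (a) $R[x]$ has FFRT over $R[x]$; (b) $R[\![x]\!]$ has FFRT over $R[\![x]\!]$; (c) $R[x_1,\ldots,x_n]$ has FFRT over $R[x_1,\ldots,x_n]$; (d) $R[\![x_1,\ldots,x_n]\!]$ has FFRT over $R[\![x_1,\ldots,x_n]\!]$.
   Context: All rings are commutative with unit. For a ring $R$ of prime characteristic $p$, an $R$-module $M$ and a positive integer $e$, $F_*^e(M)$ denotes the $R$-module which equals $M$ as an abelian group (the element corresponding to $m\in M$ is written $F_*^e(m)$) with scalar multiplication $rF_*^e(m)=F_*^e(r^{p^e}m)$ for $r\in R$, $m\in M$. Let $R$ be a Noetherian ring of prime characteristic $p$. A finitely generated $R$-module $M$ has finite F-representation type (FFRT) over $R$ by finitely generated $R$-modules $M_1,\dots,M_s$ if for every positive integer $e$ there are nonnegative integers $t_{(e,1)},\dots,t_{(e,s)}$ with $F_*^e(M)\cong\bigoplus_{j=1}^s M_j^{\oplus t_{(e,j)}}$ as $R$-modules. $M$ has FFRT if such finitely generated modules $M_1,\dots,M_s$ exist. The ring $R$ has FFRT if it has FFRT as a module over itself. *)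

theory Defs
  imports "HOL-Algebra.Algebra" "HOL-Computational_Algebra.Primes"
begin

section \<open>Modules\<close>

text \<open>
  A module is a record extending a ring record, so it carries dummy fields \<open>mult\<close> and \<open>one\<close>.
  None of the notions below depends on their values for a module.
\<close>

definition fg_module :: "('a, 'm) ring_scheme \<Rightarrow> ('a, 'b, 'n) module_scheme \<Rightarrow> bool" where
  "fg_module R M \<longleftrightarrow> module R M \<and>
     (\<exists>A. finite A \<and> A \<subseteq> carrier M \<and>
        (\<forall>x\<in>carrier M. \<exists>c\<in>A \<rightarrow> carrier R. x = (\<Oplus>\<^bsub>M\<^esub>a\<in>A. c a \<odot>\<^bsub>M\<^esub> a)))"

definition module_isomorphic ::
    "('a, 'm) ring_scheme \<Rightarrow> ('a, 'b, 'n) module_scheme \<Rightarrow> ('a, 'c, 'k) module_scheme \<Rightarrow> bool" where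
  "module_isomorphic R M N \<longleftrightarrow>
     (\<exists>f\<in>iso (add_monoid M) (add_monoid N).
        \<forall>r\<in>carrier R. \<forall>x\<in>carrier M. f (r \<odot>\<^bsub>M\<^esub> x) = r \<odot>\<^bsub>N\<^esub> f x)"

text \<open>For a finite index set the direct sum is the product.\<close>

definition finite_direct_sum ::
    "'i set \<Rightarrow> ('i \<Rightarrow> ('a, 'b, 'n) module_scheme) \<Rightarrow> ('a, 'i \<Rightarrow> 'b) module" where
  "finite_direct_sum I M =
     \<lparr>carrier = (\<Pi>\<^sub>E i\<in>I. carrier (M i)),
      monoid.mult = undefined, one = undefined,
      ring.zero = (\<lambda>i\<in>I. \<zero>\<^bsub>M i\<^esub>),
      ring.add = (\<lambda>x y. \<lambda>i\<in>I. x i \<oplus>\<^bsub>M i\<^esub> y i),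
      smult = (\<lambda>r x. \<lambda>i\<in>I. r \<odot>\<^bsub>M i\<^esub> x i)\<rparr>"

definition self_module :: "('a, 'm) ring_scheme \<Rightarrow> ('a, 'a) module" where
  "self_module R =
     \<lparr>carrier = carrier R, monoid.mult = monoid.mult R, one = \<one>\<^bsub>R\<^esub>,
      ring.zero = \<zero>\<^bsub>R\<^esub>, ring.add = ring.add R,
      smult = monoid.mult R\<rparr>"


section \<open>Finite F-representation type\<close>

text \<open>The additive order of \<open>1\<close>; the library sets it to \<open>0\<close> if that order is infinite.\<close>

definition ring_char :: "('a, 'm) ring_scheme \<Rightarrow> nat" where
  "ring_char R = group.ord (add_monoid R) \<one>\<^bsub>R\<^esub>"

definition frobenius_pushforward ::
    "('a, 'm) ring_scheme \<Rightarrow> nat \<Rightarrow> ('a, 'b, 'n) module_scheme \<Rightarrow> ('a, 'b, 'n) module_scheme" where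
  "frobenius_pushforward R e M =
     M\<lparr>smult := \<lambda>r x. (r [^]\<^bsub>R\<^esub> (ring_char R ^ e)) \<odot>\<^bsub>M\<^esub> x\<rparr>"

text \<open>The pair \<open>(j, k)\<close> stands for the \<open>k\<close>-th of the \<open>t j\<close> copies of the module \<open>Ms ! j\<close>.\<close>

definition FFRT_by ::
    "('a, 'm) ring_scheme \<Rightarrow> ('a, 'b, 'n) module_scheme \<Rightarrow> ('a, 'c, 'k) module_scheme list \<Rightarrow> bool" where
  "FFRT_by R M Ms \<longleftrightarrow>
     fg_module R M \<and> (\<forall>N\<in>set Ms. fg_module R N) \<and>
     (\<forall>e>0. \<exists>t :: nat \<Rightarrow> nat.
        module_isomorphic R (frobenius_pushforward R e M)
          (finite_direct_sum {(j, k). j < length Ms \<and> k < t j} (\<lambda>(j, k). Ms ! j)))"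

text \<open>
  HOL cannot quantify over the carrier type of the modules \<open>Ms\<close>. The type chosen here is large
  enough to contain an isomorphic copy of every finitely generated \<open>R\<close>-module (cosets of a
  submodule of some \<open>R\<^sup>n\<close>), so the choice does not matter: see \<open>fg_module_representable\<close> and
  \<open>FFRT_by_imp_FFRT\<close> below.
\<close>

definition FFRT :: "('a, 'm) ring_scheme \<Rightarrow> ('a, 'b, 'n) module_scheme \<Rightarrow> bool" where
  "FFRT R M \<longleftrightarrow> (\<exists>Ms :: ('a, (nat \<Rightarrow> 'a) set) module list. FFRT_by R M Ms)"

definition FFRT_ring :: "('a, 'm) ring_scheme \<Rightarrow> bool" where
  "FFRT_ring R \<longleftrightarrow> FFRT R (self_module R)"


section \<open>Polynomial and power series rings\<close>

text \<open>
  The univariate polynomial ring is the library's \<^const>\<open>UP\<close>.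
\<close>

definition power_series_ring :: "('a, 'm) ring_scheme \<Rightarrow> (nat \<Rightarrow> 'a) ring" where
  "power_series_ring R =
     \<lparr>carrier = UNIV \<rightarrow> carrier R,
      monoid.mult = (\<lambda>f g n. \<Oplus>\<^bsub>R\<^esub>i\<in>{..n}. f i \<otimes>\<^bsub>R\<^esub> g (n - i)),
      one = (\<lambda>n. if n = 0 then \<one>\<^bsub>R\<^esub> else \<zero>\<^bsub>R\<^esub>),
      ring.zero = (\<lambda>n. \<zero>\<^bsub>R\<^esub>),
      ring.add = (\<lambda>f g n. f n \<oplus>\<^bsub>R\<^esub> g n)\<rparr>"

text \<open>
  In several variables, a monomial in the variables \<open>x\<^sub>i\<close>, \<open>i \<in> I\<close>, is a multiset
  over \<open>I\<close>, and a power series is its coefficient function, as in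
  \<^theory>\<open>HOL-Algebra.Indexed_Polynomials\<close>. The coefficient function is defined on all
  multisets and is required to vanish on those that involve a variable outside \<open>I\<close>.
\<close>

definition mv_power_series_ring ::
    "'i set \<Rightarrow> ('a, 'm) ring_scheme \<Rightarrow> ('i multiset \<Rightarrow> 'a) ring" where
  "mv_power_series_ring I R =
     \<lparr>carrier = {f. (\<forall>m. f m \<in> carrier R) \<and> (\<forall>m. \<not> set_mset m \<subseteq> I \<longrightarrow> f m = \<zero>\<^bsub>R\<^esub>)},
      monoid.mult = (\<lambda>f g m. \<Oplus>\<^bsub>R\<^esub>k\<in>{k. k \<subseteq># m}. f k \<otimes>\<^bsub>R\<^esub> g (m - k)),
      one = (\<lambda>m. if m = {#} then \<one>\<^bsub>R\<^esub> else \<zero>\<^bsub>R\<^esub>),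
      ring.zero = (\<lambda>m. \<zero>\<^bsub>R\<^esub>),
      ring.add = (\<lambda>f g m. f m \<oplus>\<^bsub>R\<^esub> g m)\<rparr>"

definition mv_poly_ring ::
    "'i set \<Rightarrow> ('a, 'm) ring_scheme \<Rightarrow> ('i multiset \<Rightarrow> 'a) ring" where
  "mv_poly_ring I R = (mv_power_series_ring I R)
     \<lparr>carrier := {f \<in> carrier (mv_power_series_ring I R). finite {m. f m \<noteq> \<zero>\<^bsub>R\<^esub>}}\<rparr>"


section \<open>Independence of the carrier type\<close>

text \<open>Transport of structure along an injection.\<close>

definition transport_module ::
    "('b \<Rightarrow> 'c) \<Rightarrow> ('a, 'b, 'n) module_scheme \<Rightarrow> ('a, 'c) module" where
  "transport_module h M =
     (let g = inv_into (carrier M) h in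
     \<lparr>carrier = h ` carrier M, monoid.mult = undefined, one = undefined,
      ring.zero = h \<zero>\<^bsub>M\<^esub>,
      ring.add = (\<lambda>x y. h (g x \<oplus>\<^bsub>M\<^esub> g y)),
      smult = (\<lambda>r x. h (r \<odot>\<^bsub>M\<^esub> g x))\<rparr>)"

lemma transport_module_iso:
  assumes M: "module R M" and h: "inj_on h (carrier M)"
  shows "module R (transport_module h M)"
    and "h \<in> iso (add_monoid M) (add_monoid (transport_module h M))"
    and "\<And>r x. \<lbrakk>r \<in> carrier R; x \<in> carrier M\<rbrakk> \<Longrightarrow>
           h (r \<odot>\<^bsub>M\<^esub> x) = r \<odot>\<^bsub>transport_module h M\<^esub> h x"
proof -
  interpret module R M by (rule M)
  have [simp]: "inv_into (carrier M) h (h x) = x" if "x \<in> carrier M" for x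
    using h that by simp
  let ?T = "transport_module h M"
  have T: "carrier ?T = h ` carrier M" "\<zero>\<^bsub>?T\<^esub> = h \<zero>\<^bsub>M\<^esub>"
    "\<And>x y. \<lbrakk>x \<in> carrier M; y \<in> carrier M\<rbrakk> \<Longrightarrow> h x \<oplus>\<^bsub>?T\<^esub> h y = h (x \<oplus>\<^bsub>M\<^esub> y)"
    "\<And>r x. x \<in> carrier M \<Longrightarrow> r \<odot>\<^bsub>?T\<^esub> h x = h (r \<odot>\<^bsub>M\<^esub> x)"
    by (simp_all add: transport_module_def Let_def)
  show "h \<in> iso (add_monoid M) (add_monoid ?T)"
    using h by (auto simp: iso_def hom_def bij_betw_def T)
  show "h (r \<odot>\<^bsub>M\<^esub> x) = r \<odot>\<^bsub>?T\<^esub> h x"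
    if "r \<in> carrier R" "x \<in> carrier M" for r x
    using that by (simp add: T)
  have ag: "abelian_group ?T"
  proof (rule abelian_groupI)
    fix x assume "x \<in> carrier ?T"
    then obtain u where u: "u \<in> carrier M" "x = h u" by (auto simp: T)
    then have "h (\<ominus>\<^bsub>M\<^esub> u) \<in> carrier ?T" "h (\<ominus>\<^bsub>M\<^esub> u) \<oplus>\<^bsub>?T\<^esub> x = \<zero>\<^bsub>?T\<^esub>"
      by (simp_all add: T M.l_neg)
    then show "\<exists>y\<in>carrier ?T. y \<oplus>\<^bsub>?T\<^esub> x = \<zero>\<^bsub>?T\<^esub>" by blast
  next
    fix x y assume "x \<in> carrier ?T" "y \<in> carrier ?T"
    then obtain u v where "u \<in> carrier M" "x = h u" "v \<in> carrier M" "y = h v" by (auto simp: T)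
    then show "x \<oplus>\<^bsub>?T\<^esub> y \<in> carrier ?T" "x \<oplus>\<^bsub>?T\<^esub> y = y \<oplus>\<^bsub>?T\<^esub> x"
      using M.a_comm[of u v] by (simp_all add: T)
  qed (auto simp: T M.a_assoc)
  show "module R ?T"
    by (rule moduleI[OF R.is_cring ag])
      (auto simp: T smult_l_distr smult_r_distr smult_assoc1)
qed

lemma fg_module_cong_iso:
  fixes M :: "('a, 'b, 'n) module_scheme" and N :: "('a, 'c, 'k) module_scheme"
  assumes M: "fg_module R M" and N: "module R N"
    and f: "f \<in> iso (add_monoid M) (add_monoid N)"
    and smult: "\<And>r x. \<lbrakk>r \<in> carrier R; x \<in> carrier M\<rbrakk> \<Longrightarrow> f (r \<odot>\<^bsub>M\<^esub> x) = r \<odot>\<^bsub>N\<^esub> f x"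
  shows "fg_module R N"
proof -
  interpret M: module R M using M by (simp add: fg_module_def)
  interpret N: module R N by (rule N)
  from f have bij: "bij_betw f (carrier M) (carrier N)" by (simp add: iso_def)
  from f have add: "f (x \<oplus>\<^bsub>M\<^esub> y) = f x \<oplus>\<^bsub>N\<^esub> f y" if "x \<in> carrier M" "y \<in> carrier M" for x y
    using that by (simp add: iso_def hom_def)
  have cl: "f x \<in> carrier N" if "x \<in> carrier M" for x using bij that by (auto simp: bij_betw_def)
  have zero: "f \<zero>\<^bsub>M\<^esub> = \<zero>\<^bsub>N\<^esub>"
    using add[of "\<zero>\<^bsub>M\<^esub>" "\<zero>\<^bsub>M\<^esub>"] cl[of "\<zero>\<^bsub>M\<^esub>"] by (simp add: N.add.r_cancel_one')
  obtain A where A: "finite A" "A \<subseteq> carrier M"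
    "\<And>x. x \<in> carrier M \<Longrightarrow> \<exists>c\<in>A \<rightarrow> carrier R. x = (\<Oplus>\<^bsub>M\<^esub>a\<in>A. c a \<odot>\<^bsub>M\<^esub> a)"
    using M unfolding fg_module_def by blast
  have sum: "f (\<Oplus>\<^bsub>M\<^esub>a\<in>B. u a) = (\<Oplus>\<^bsub>N\<^esub>a\<in>B. f (u a))"
    if "finite B" "u \<in> B \<rightarrow> carrier M" for B :: "'b set" and u
    using that
  proof (induction B)
    case (insert b B)
    then have "u b \<in> carrier M" "u \<in> B \<rightarrow> carrier M" by auto
    moreover from this have "(\<lambda>a. f (u a)) \<in> B \<rightarrow> carrier N" using cl by blast
    ultimately show ?case
      using insert by (simp add: add cl M.M.finsum_insert N.M.finsum_insert M.M.finsum_closed)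
  qed (simp add: zero)
  have injA: "inj_on f A" by (rule inj_on_subset[OF bij_betw_imp_inj_on[OF bij] A(2)])
  have "\<exists>c\<in>f ` A \<rightarrow> carrier R. y = (\<Oplus>\<^bsub>N\<^esub>a\<in>f ` A. c a \<odot>\<^bsub>N\<^esub> a)" if y: "y \<in> carrier N" for y
  proof -
    obtain x where x: "x \<in> carrier M" "y = f x"
      using y bij_betw_imp_surj_on[OF bij] by blast
    obtain c where c: "c \<in> A \<rightarrow> carrier R" "x = (\<Oplus>\<^bsub>M\<^esub>a\<in>A. c a \<odot>\<^bsub>M\<^esub> a)" using A(3)[OF x(1)] ..
    let ?c = "\<lambda>b. c (inv_into A f b)"
    have "y = (\<Oplus>\<^bsub>N\<^esub>a\<in>A. f (c a \<odot>\<^bsub>M\<^esub> a))"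
      unfolding x(2) c(2) using A c(1) by (intro sum) auto
    also have "\<dots> = (\<Oplus>\<^bsub>N\<^esub>a\<in>A. ?c (f a) \<odot>\<^bsub>N\<^esub> f a)"
      using A c(1) injA cl by (intro N.finsum_cong') (auto simp: smult Pi_def subset_iff)
    also have "\<dots> = (\<Oplus>\<^bsub>N\<^esub>b\<in>f ` A. ?c b \<odot>\<^bsub>N\<^esub> b)"
      using A c(1) injA cl by (intro N.finsum_reindex[symmetric]) (auto simp: Pi_def subset_iff)
    finally show ?thesis using c(1) injA by (intro bexI[of _ ?c]) (auto simp: Pi_def)
  qed
  moreover have "finite (f ` A)" "f ` A \<subseteq> carrier N" using A cl by auto
  ultimately show ?thesis unfolding fg_module_def using N by blast
qed

lemma fg_module_representable_aux:
  fixes R :: "('a, 'm) ring_scheme" and M :: "('a, 'b, 'n) module_scheme"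
  assumes M: "fg_module R M"
  shows "\<exists>(N :: ('a, (nat \<Rightarrow> 'a) set) module) h. fg_module R N \<and>
     h \<in> iso (add_monoid M) (add_monoid N) \<and>
     (\<forall>r\<in>carrier R. \<forall>x\<in>carrier M. h (r \<odot>\<^bsub>M\<^esub> x) = r \<odot>\<^bsub>N\<^esub> h x)"
proof -
  interpret M: module R M using M by (simp add: fg_module_def)
  obtain A where A: "finite A" "A \<subseteq> carrier M"
    "\<And>x. x \<in> carrier M \<Longrightarrow> \<exists>c\<in>A \<rightarrow> carrier R. x = (\<Oplus>\<^bsub>M\<^esub>a\<in>A. c a \<odot>\<^bsub>M\<^esub> a)"
    using M unfolding fg_module_def by blast
  have "\<exists>k :: 'b \<Rightarrow> nat. inj_on k A"
    using finite_imp_inj_to_nat_seg[OF A(1)] by (elim exE conjE) (rule exI)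
  then obtain k :: "'b \<Rightarrow> nat" where k: "inj_on k A" ..
  define h where "h x = {c :: nat \<Rightarrow> 'a. c \<in> UNIV \<rightarrow> carrier R \<and> x = (\<Oplus>\<^bsub>M\<^esub>a\<in>A. c (k a) \<odot>\<^bsub>M\<^esub> a)}" for x
  have ne: "h x \<noteq> {}" if x: "x \<in> carrier M" for x
  proof -
    obtain c where c: "c \<in> A \<rightarrow> carrier R" "x = (\<Oplus>\<^bsub>M\<^esub>a\<in>A. c a \<odot>\<^bsub>M\<^esub> a)" using A(3)[OF x] ..
    define d where "d i = (if i \<in> k ` A then c (inv_into A k i) else \<zero>\<^bsub>R\<^esub>)" for i
    have "d \<in> UNIV \<rightarrow> carrier R" using c(1) k by (auto simp: d_def Pi_def)
    moreover have "x = (\<Oplus>\<^bsub>M\<^esub>a\<in>A. d (k a) \<odot>\<^bsub>M\<^esub> a)"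
      unfolding c(2) using c(1) A k by (intro M.M.finsum_cong') (auto simp: d_def Pi_def subset_iff)
    ultimately show ?thesis by (auto simp: h_def)
  qed
  have inj: "inj_on h (carrier M)"
  proof (rule inj_onI)
    fix x y assume "x \<in> carrier M" "h x = h y"
    then obtain c where "c \<in> h x" "c \<in> h y" using ne by blast
    then show "x = y" by (simp add: h_def)
  qed
  note t = transport_module_iso[OF M.module_axioms inj]
  show ?thesis
    using fg_module_cong_iso[OF M t(1,2)] t by blast
qed

lemma fg_module_representable:
  fixes R :: "('a, 'm) ring_scheme" and M :: "('a, 'b, 'n) module_scheme"
  assumes "fg_module R M"
  shows "\<exists>N :: ('a, (nat \<Rightarrow> 'a) set) module. fg_module R N \<and> module_isomorphic R M N"
  using fg_module_representable_aux[OF assms] unfolding module_isomorphic_def by blast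

lemma module_isomorphic_trans:
  assumes "module_isomorphic R M N" "module_isomorphic R N P"
  shows "module_isomorphic R M P"
proof -
  obtain f where f: "f \<in> iso (add_monoid M) (add_monoid N)"
    "\<forall>r\<in>carrier R. \<forall>x\<in>carrier M. f (r \<odot>\<^bsub>M\<^esub> x) = r \<odot>\<^bsub>N\<^esub> f x"
    using assms(1) unfolding module_isomorphic_def by blast
  obtain g where g: "g \<in> iso (add_monoid N) (add_monoid P)"
    "\<forall>r\<in>carrier R. \<forall>x\<in>carrier N. g (r \<odot>\<^bsub>N\<^esub> x) = r \<odot>\<^bsub>P\<^esub> g x"
    using assms(2) unfolding module_isomorphic_def by blast
  have "f x \<in> carrier N" if "x \<in> carrier M" for x
    using f(1) that by (auto simp: iso_def hom_def)
  then have "\<forall>r\<in>carrier R. \<forall>x\<in>carrier M. (g \<circ> f) (r \<odot>\<^bsub>M\<^esub> x) = r \<odot>\<^bsub>P\<^esub> (g \<circ> f) x"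
    using f(2) g(2) by simp
  moreover have "g \<circ> f \<in> iso (add_monoid M) (add_monoid P)"
    by (rule iso_set_trans[OF f(1) g(1)])
  ultimately show ?thesis unfolding module_isomorphic_def by blast
qed

lemma finite_direct_sum_cong_iso:
  assumes M: "\<And>i. i \<in> I \<Longrightarrow> module R (M i)" and N: "\<And>i. i \<in> I \<Longrightarrow> module R (N i)"
    and iso: "\<And>i. i \<in> I \<Longrightarrow> module_isomorphic R (M i) (N i)"
  shows "module_isomorphic R (finite_direct_sum I M) (finite_direct_sum I N)"
proof -
  have "\<forall>i\<in>I. \<exists>f. f \<in> iso (add_monoid (M i)) (add_monoid (N i)) \<and>
      (\<forall>r\<in>carrier R. \<forall>x\<in>carrier (M i). f (r \<odot>\<^bsub>M i\<^esub> x) = r \<odot>\<^bsub>N i\<^esub> f x)"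
    using iso unfolding module_isomorphic_def by blast
  then obtain f where f: "\<And>i. i \<in> I \<Longrightarrow> f i \<in> iso (add_monoid (M i)) (add_monoid (N i))"
    "\<And>i r x. \<lbrakk>i \<in> I; r \<in> carrier R; x \<in> carrier (M i)\<rbrakk> \<Longrightarrow>
       f i (r \<odot>\<^bsub>M i\<^esub> x) = r \<odot>\<^bsub>N i\<^esub> f i x"
    by metis
  have bij: "bij_betw (f i) (carrier (M i)) (carrier (N i))" if "i \<in> I" for i
    using f(1)[OF that] by (simp add: iso_def)
  have add: "f i (x \<oplus>\<^bsub>M i\<^esub> y) = f i x \<oplus>\<^bsub>N i\<^esub> f i y"
    if "i \<in> I" "x \<in> carrier (M i)" "y \<in> carrier (M i)" for i x y
    using f(1)[OF that(1)] that by (simp add: iso_def hom_def)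
  define F where "F x = (\<lambda>i\<in>I. f i (x i))" for x
  define G where "G y = (\<lambda>i\<in>I. inv_into (carrier (M i)) (f i) (y i))" for y
  note [simp] = finite_direct_sum_def
  have cl: "f i x \<in> carrier (N i)" if "i \<in> I" "x \<in> carrier (M i)" for i x
    using bij[OF that(1)] that(2) by (auto simp: bij_betw_def)
  have inv_cl: "inv_into (carrier (M i)) (f i) y \<in> carrier (M i)"
    "f i (inv_into (carrier (M i)) (f i) y) = y" if "i \<in> I" "y \<in> carrier (N i)" for i y
    using bij[OF that(1)] that(2)
    by (auto simp: bij_betw_def inv_into_into f_inv_into_f)
  have inv_f: "inv_into (carrier (M i)) (f i) (f i x) = x" if "i \<in> I" "x \<in> carrier (M i)" for i x
    using bij[OF that(1)] that(2) by (auto simp: bij_betw_def)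
  have "bij_betw F (\<Pi>\<^sub>E i\<in>I. carrier (M i)) (\<Pi>\<^sub>E i\<in>I. carrier (N i))"
  proof (rule bij_betw_byWitness[where f' = G])
    show "\<forall>x\<in>\<Pi>\<^sub>E i\<in>I. carrier (M i). G (F x) = x"
      by (auto simp: F_def G_def fun_eq_iff inv_f PiE_iff extensional_def)
    show "\<forall>y\<in>\<Pi>\<^sub>E i\<in>I. carrier (N i). F (G y) = y"
      by (auto simp: F_def G_def fun_eq_iff inv_cl PiE_iff extensional_def)
  qed (auto simp: F_def G_def cl inv_cl PiE_iff)
  then have "F \<in> iso (add_monoid (finite_direct_sum I M)) (add_monoid (finite_direct_sum I N))"
    by (auto simp: iso_def hom_def bij_betw_def F_def fun_eq_iff add PiE_iff cl)
  moreover have "\<forall>r\<in>carrier R. \<forall>x\<in>carrier (finite_direct_sum I M).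
      F (r \<odot>\<^bsub>finite_direct_sum I M\<^esub> x) = r \<odot>\<^bsub>finite_direct_sum I N\<^esub> F x"
    by (auto simp: F_def fun_eq_iff f(2) PiE_iff)
  ultimately show ?thesis unfolding module_isomorphic_def by blast
qed

lemma FFRT_by_imp_FFRT:
  fixes R :: "('a, 'm) ring_scheme" and M :: "('a, 'b, 'n) module_scheme"
    and Ms :: "('a, 'c, 'k) module_scheme list"
  assumes "FFRT_by R M Ms"
  shows "FFRT R M"
proof -
  have fg: "fg_module R N" if "N \<in> set Ms" for N using assms that by (simp add: FFRT_by_def)
  obtain r :: "('a, 'c, 'k) module_scheme \<Rightarrow> ('a, (nat \<Rightarrow> 'a) set) module" where
    r: "\<And>N. N \<in> set Ms \<Longrightarrow> fg_module R (r N) \<and> module_isomorphic R N (r N)"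
    using fg_module_representable[OF fg] by metis
  have "FFRT_by R M (map r Ms)"
    unfolding FFRT_by_def
  proof (intro conjI ballI allI impI)
    show "fg_module R M" using assms by (simp add: FFRT_by_def)
    show "fg_module R N" if "N \<in> set (map r Ms)" for N using that r by auto
    fix e :: nat assume "e > 0"
    then obtain t :: "nat \<Rightarrow> nat" where t: "module_isomorphic R (frobenius_pushforward R e M)
        (finite_direct_sum {(j, k). j < length Ms \<and> k < t j} (\<lambda>(j, k). Ms ! j))"
      using assms unfolding FFRT_by_def by blast
    let ?I = "{(j, k). j < length Ms \<and> k < t j}"
    have "module_isomorphic R (finite_direct_sum ?I (\<lambda>(j, k). Ms ! j))
        (finite_direct_sum ?I (\<lambda>(j, k). map r Ms ! j))"
      by (rule finite_direct_sum_cong_iso) (use fg r in \<open>auto simp: fg_module_def\<close>)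
    with t have "module_isomorphic R (frobenius_pushforward R e M)
        (finite_direct_sum ?I (\<lambda>(j, k). map r Ms ! j))"
      by (rule module_isomorphic_trans)
    then show "\<exists>t :: nat \<Rightarrow> nat. module_isomorphic R (frobenius_pushforward R e M)
        (finite_direct_sum {(j, k). j < length (map r Ms) \<and> k < t j} (\<lambda>(j, k). map r Ms ! j))"
      unfolding length_map by (rule exI[of _ t])
  qed
  then show ?thesis unfolding FFRT_def by blast
qed

end

theory Submission
  imports Defs
begin

text \<open>
  Consider \<open>n\<close> variables, and let \<open>q = p\<^sup>e\<close>. Every exponent is \<open>b + q k\<close> for exactly one \<open>b\<close> with
  all entries below \<open>q\<close>. Sorting the coefficients of a polynomial or power series by the
  remainder \<open>b\<close> therefore splits \<open>F\<^sub>*\<^sup>e\<close> of the ring into \<open>q\<^sup>n\<close> summands.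
  In characteristic \<open>p\<close> the power \<open>r\<^sup>q\<close> of a series \<open>r\<close> has the coefficient
  \<open>(r\<^sub>k)\<^sup>q\<close> at \<open>q k\<close> and vanishes off the multiples of \<open>q\<close>
  (\<open>frobenius_power_coeff\<close>), so multiplication by \<open>r\<^sup>q\<close> respects this splitting and acts
  on each summand as \<open>r\<close> acts on the series with coefficients in \<open>F\<^sub>*\<^sup>e R\<close>. Thus
  \<open>F\<^sub>*\<^sup>e (R[[x]])\<close> is the direct sum of \<open>q\<^sup>n\<close> copies of \<open>(F\<^sub>*\<^sup>e R)[[x]]\<close>, and
  likewise for polynomials (\<open>frobenius_pushforward_series\<close>).

  Passing from a module \<open>M\<close> to the module \<open>M[[x]]\<close> of series with coefficients in \<open>M\<close>
  commutes with finite direct sums (\<open>series_module_direct_sum\<close>) and preserves finite generation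
  (\<open>fg_series_module\<close>). So if \<open>R\<close> has FFRT by \<open>M\<^sub>1, \<dots>, M\<^sub>s\<close>, then the
  series ring has FFRT by \<open>M\<^sub>1[[x]], \<dots>, M\<^sub>s[[x]]\<close>, with all multiplicities for
  \<open>e\<close> multiplied by \<open>q\<^sup>n\<close> (\<open>FFRT_series_ring\<close>).

  The properties of exponents behind this are that each has finitely many decompositions into a sum of
  two, and that division with remainder by \<open>q\<close> is possible with finitely many remainders. The
  argument is therefore carried out once, for families of coefficients indexed by a monoid of
  exponents, with finite support or arbitrary. One variable is the monoid of natural numbers, several
  variables are the monoid of multisets over the set of variables.
\<close>

section \<open>The Frobenius endomorphism\<close>

context cring
begin

lemma binomial_theorem:
  assumes a: "a \<in> carrier R" and b: "b \<in> carrier R"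
  shows "(a \<oplus> b) [^] n = (\<Oplus>k\<in>{..n}. [(n choose k)] \<cdot> (a [^] k \<otimes> b [^] (n - k)))"
proof (induction n)
  case 0
  show ?case using a b by simp
next
  case (Suc n)
  define t where "t k = a [^] k \<otimes> b [^] (Suc n - k)" for k
  have t: "t k \<in> carrier R" for k using a b by (simp add: t_def)
  have ta: "(a [^] k \<otimes> b [^] (n - k)) \<otimes> a = t (Suc k)" for k
    using a b by (simp add: t_def m_ac)
  have tb: "(a [^] k \<otimes> b [^] (n - k)) \<otimes> b = t k" if "k \<le> n" for k
    using a b that by (simp add: t_def m_ac Suc_diff_le)
  have "(a \<oplus> b) [^] Suc n
      = (\<Oplus>k\<in>{..n}. [(n choose k)] \<cdot> (a [^] k \<otimes> b [^] (n - k))) \<otimes> a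
        \<oplus> (\<Oplus>k\<in>{..n}. [(n choose k)] \<cdot> (a [^] k \<otimes> b [^] (n - k))) \<otimes> b"
    using a b by (simp add: Suc r_distr)
  also have "(\<Oplus>k\<in>{..n}. [(n choose k)] \<cdot> (a [^] k \<otimes> b [^] (n - k))) \<otimes> a
      = (\<Oplus>k\<in>{..n}. [(n choose k)] \<cdot> t (Suc k))"
    using a b t by (subst finsum_ldistr) (auto simp: add_pow_ldistr ta intro!: finsum_cong')
  also have "(\<Oplus>k\<in>{..n}. [(n choose k)] \<cdot> (a [^] k \<otimes> b [^] (n - k))) \<otimes> b
      = (\<Oplus>k\<in>{..n}. [(n choose k)] \<cdot> t k)"
    using a b t by (subst finsum_ldistr) (auto simp: add_pow_ldistr tb intro!: finsum_cong')
  also have "\<dots> = (\<Oplus>k\<in>{..Suc n}. [(n choose k)] \<cdot> t k)"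
    using t by (simp add: Pi_def add.nat_pow_0 binomial_eq_0)
  also have "\<dots> = (\<Oplus>k\<in>{..n}. [(n choose Suc k)] \<cdot> t (Suc k)) \<oplus> [(n choose 0)] \<cdot> t 0"
    using t by (intro finsum_Suc2) auto
  finally have "(a \<oplus> b) [^] Suc n
      = (\<Oplus>k\<in>{..n}. [(n choose k)] \<cdot> t (Suc k) \<oplus> [(n choose Suc k)] \<cdot> t (Suc k)) \<oplus> t 0"
    using t by (simp add: a_assoc finsum_addf Pi_def)
  also have "\<dots> = (\<Oplus>k\<in>{..n}. [(Suc n choose Suc k)] \<cdot> t (Suc k)) \<oplus> [(Suc n choose 0)] \<cdot> t 0"
    using t by (simp add: add.nat_pow_mult)
  also have "\<dots> = (\<Oplus>k\<in>{..Suc n}. [(Suc n choose k)] \<cdot> t k)"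
    using t by (intro finsum_Suc2[symmetric]) auto
  finally show ?case by (simp add: t_def)
qed

lemma ring_char_dvd_iff: "ring_char R dvd n \<longleftrightarrow> [n] \<cdot> \<one> = \<zero>"
  unfolding ring_char_def using add.pow_eq_id[of \<one> n] by simp

lemma char_multiple_annihilates:
  assumes "ring_char R dvd n" and a: "a \<in> carrier R"
  shows "[n] \<cdot> a = \<zero>"
  using assms ring_char_dvd_iff[of n] add_pow_ldistr[of \<one> a n] by simp

text \<open>
  The inner binomial coefficients of \<open>(a + b)\<^sup>p\<close> are divisible by \<open>p\<close>.
\<close>

lemma frobenius_add:
  assumes p: "Factorial_Ring.prime (ring_char R)"
    and a: "a \<in> carrier R" and b: "b \<in> carrier R"
  shows "(a \<oplus> b) [^] ring_char R = a [^] ring_char R \<oplus> b [^] ring_char R"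
proof -
  let ?p = "ring_char R"
  let ?t = "\<lambda>k. [(?p choose k)] \<cdot> (a [^] k \<otimes> b [^] (?p - k))"
  have p0: "0 < ?p" using p by (rule prime_gt_0_nat)
  have "(a \<oplus> b) [^] ?p = (\<Oplus>k\<in>{..?p}. ?t k)"
    by (rule binomial_theorem[OF a b])
  also have "\<dots> = (\<Oplus>k\<in>{0, ?p}. ?t k)"
  proof (rule add.finprod_mono_neutral_cong_right)
    fix k assume k: "k \<in> {..?p} - {0, ?p}"
    then have "?p dvd (?p choose k)" by (intro dvd_choose_prime) (use p p0 in auto)
    then show "?t k = \<zero>" using a b by (intro char_multiple_annihilates) auto
  qed (use a b in auto)
  also have "\<dots> = a [^] ?p \<oplus> b [^] ?p"
    using a b p0 by (simp add: a_comm)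
  finally show ?thesis .
qed

lemma frobenius_finsum:
  assumes p: "Factorial_Ring.prime (ring_char R)"
    and "finite A" and "u \<in> A \<rightarrow> carrier R"
  shows "(\<Oplus>i\<in>A. u i) [^] ring_char R = (\<Oplus>i\<in>A. u i [^] ring_char R)"
  using assms(2,3)
proof (induction A)
  case empty
  show ?case using prime_gt_0_nat[OF p] by (simp add: nat_pow_zero)
next
  case (insert i A)
  then show ?case by (simp add: frobenius_add[OF p] Pi_def)
qed

lemma frobenius_power_add:
  assumes p: "Factorial_Ring.prime (ring_char R)"
    and a: "a \<in> carrier R" and b: "b \<in> carrier R"
  shows "(a \<oplus> b) [^] (ring_char R ^ e) = a [^] (ring_char R ^ e) \<oplus> b [^] (ring_char R ^ e)"
proof (induction e)
  case 0
  show ?case using a b by simp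
next
  case (Suc e)
  have "x [^] (ring_char R ^ Suc e) = (x [^] (ring_char R ^ e)) [^] ring_char R"
    if "x \<in> carrier R" for x
    using that by (simp add: nat_pow_pow mult.commute)
  then show ?case using a b by (simp add: Suc frobenius_add[OF p])
qed

end

section \<open>Finite sums, modules and direct sums\<close>

lemma (in abelian_monoid) finsum_Sigma:
  assumes "finite A" and "\<And>a. a \<in> A \<Longrightarrow> finite (B a)"
    and "\<And>a b. \<lbrakk>a \<in> A; b \<in> B a\<rbrakk> \<Longrightarrow> g a b \<in> carrier G"
  shows "(\<Oplus>a\<in>A. \<Oplus>b\<in>B a. g a b) = (\<Oplus>x\<in>Sigma A B. g (fst x) (snd x))"
  using assms
proof (induction A)
  case empty
  show ?case by simp
next
  case (insert a A)
  have g: "(\<lambda>x. g (fst x) (snd x)) \<in> Sigma A B \<rightarrow> carrier G" using insert.prems by auto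
  have ga: "(\<lambda>x. g (fst x) (snd x)) \<in> Pair a ` B a \<rightarrow> carrier G" using insert.prems by auto
  have "Sigma (insert a A) B = Pair a ` B a \<union> Sigma A B" by auto
  moreover have "Pair a ` B a \<inter> Sigma A B = {}" using insert.hyps by auto
  ultimately have "(\<Oplus>x\<in>Sigma (insert a A) B. g (fst x) (snd x))
      = (\<Oplus>x\<in>Pair a ` B a. g (fst x) (snd x)) \<oplus> (\<Oplus>x\<in>Sigma A B. g (fst x) (snd x))"
    using insert g ga by (simp add: add.finprod_Un_disjoint)
  also have "(\<Oplus>x\<in>Pair a ` B a. g (fst x) (snd x)) = (\<Oplus>b\<in>B a. g a b)"
    using insert.prems by (subst add.finprod_reindex) (auto simp: inj_on_def)
  also have "(\<Oplus>x\<in>Sigma A B. g (fst x) (snd x)) = (\<Oplus>a\<in>A. \<Oplus>b\<in>B a. g a b)"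
    using insert by simp
  finally show ?case
    using insert by (simp add: Pi_def finsum_closed)
qed

lemma (in abelian_monoid) finsum_eq_single:
  assumes "finite A" "a \<in> A" "f a \<in> carrier G"
    and "\<And>x. \<lbrakk>x \<in> A; x \<noteq> a\<rbrakk> \<Longrightarrow> f x = \<zero>"
  shows "(\<Oplus>x\<in>A. f x) = f a"
proof -
  have "(\<Oplus>x\<in>A. f x) = (\<Oplus>x\<in>{a}. f x)"
    by (rule add.finprod_mono_neutral_cong_right) (use assms in \<open>auto simp: Pi_def\<close>, metis assms(3,4) zero_closed)
  then show ?thesis using assms by simp
qed

lemma (in module) finsum_smult_rdistr:
  assumes "finite A" "x \<in> carrier M" "c \<in> A \<rightarrow> carrier R"
  shows "(\<Oplus>\<^bsub>R\<^esub>i\<in>A. c i) \<odot>\<^bsub>M\<^esub> x = (\<Oplus>\<^bsub>M\<^esub>i\<in>A. c i \<odot>\<^bsub>M\<^esub> x)"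
  using assms(1,3) by (induction A) (use assms(2) in \<open>auto simp: Pi_def smult_l_distr\<close>)

lemma module_self_module:
  assumes "cring R"
  shows "module R (self_module R)"
proof -
  interpret cring R by fact
  show ?thesis
  proof (rule moduleI)
    show "abelian_group (self_module R)"
    proof (rule abelian_groupI)
      fix x assume "x \<in> carrier (self_module R)"
      then show "\<exists>y\<in>carrier (self_module R). y \<oplus>\<^bsub>self_module R\<^esub> x = \<zero>\<^bsub>self_module R\<^esub>"
        by (intro bexI[of _ "\<ominus>\<^bsub>R\<^esub> x"]) (simp_all add: self_module_def l_neg)
    qed (auto simp: self_module_def add.m_ac)
  qed (auto simp: self_module_def l_distr r_distr m_assoc intro: is_cring)
qed

lemma module_frobenius_pushforward:
  assumes M: "module R M" and p: "Factorial_Ring.prime (ring_char R)"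
  shows "module R (frobenius_pushforward R e M)"
proof -
  interpret module R M by fact
  let ?F = "frobenius_pushforward R e M"
  have "carrier ?F = carrier M" "\<zero>\<^bsub>?F\<^esub> = \<zero>\<^bsub>M\<^esub>" "add ?F = add M"
    and smult: "\<And>r x. r \<odot>\<^bsub>?F\<^esub> x = (r [^]\<^bsub>R\<^esub> (ring_char R ^ e)) \<odot>\<^bsub>M\<^esub> x"
    by (simp_all add: frobenius_pushforward_def)
  note F = this
  show ?thesis
  proof (rule moduleI)
    show "abelian_group ?F"
    proof (rule abelian_groupI)
      fix x assume "x \<in> carrier ?F"
      then show "\<exists>y\<in>carrier ?F. y \<oplus>\<^bsub>?F\<^esub> x = \<zero>\<^bsub>?F\<^esub>"
        by (intro bexI[of _ "\<ominus>\<^bsub>M\<^esub> x"]) (simp_all add: F M.l_neg)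
    qed (auto simp: F M.add.m_ac)
  qed (auto simp: F smult_l_distr smult_r_distr smult_assoc1 nat_pow_distrib
      frobenius_power_add[OF p] intro: is_cring)
qed

lemma module_isomorphicI:
  assumes "\<And>x. x \<in> carrier M \<Longrightarrow> f x \<in> carrier N"
    and "\<And>y. y \<in> carrier N \<Longrightarrow> g y \<in> carrier M"
    and "\<And>x. x \<in> carrier M \<Longrightarrow> g (f x) = x"
    and "\<And>y. y \<in> carrier N \<Longrightarrow> f (g y) = y"
    and "\<And>x y. \<lbrakk>x \<in> carrier M; y \<in> carrier M\<rbrakk> \<Longrightarrow> f (x \<oplus>\<^bsub>M\<^esub> y) = f x \<oplus>\<^bsub>N\<^esub> f y"
    and "\<And>r x. \<lbrakk>r \<in> carrier R; x \<in> carrier M\<rbrakk> \<Longrightarrow> f (r \<odot>\<^bsub>M\<^esub> x) = r \<odot>\<^bsub>N\<^esub> f x"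
  shows "module_isomorphic R M N"
proof -
  have "bij_betw f (carrier M) (carrier N)"
    by (rule bij_betw_byWitness[where f' = g]) (use assms in auto)
  then have "f \<in> iso (add_monoid M) (add_monoid N)"
    using assms by (auto simp: iso_def hom_def)
  then show ?thesis unfolding module_isomorphic_def using assms(6) by blast
qed

lemma finite_direct_sum_simps [simp]:
  "carrier (finite_direct_sum I M) = (\<Pi>\<^sub>E i\<in>I. carrier (M i))"
  "\<zero>\<^bsub>finite_direct_sum I M\<^esub> = (\<lambda>i\<in>I. \<zero>\<^bsub>M i\<^esub>)"
  "x \<oplus>\<^bsub>finite_direct_sum I M\<^esub> y = (\<lambda>i\<in>I. x i \<oplus>\<^bsub>M i\<^esub> y i)"
  "r \<odot>\<^bsub>finite_direct_sum I M\<^esub> x = (\<lambda>i\<in>I. r \<odot>\<^bsub>M i\<^esub> x i)"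
  by (simp_all add: finite_direct_sum_def)

lemma frobenius_pushforward_simps [simp]:
  "carrier (frobenius_pushforward R e M) = carrier M"
  "\<zero>\<^bsub>frobenius_pushforward R e M\<^esub> = \<zero>\<^bsub>M\<^esub>"
  "add (frobenius_pushforward R e M) = add M"
  "r \<odot>\<^bsub>frobenius_pushforward R e M\<^esub> x = (r [^]\<^bsub>R\<^esub> (ring_char R ^ e)) \<odot>\<^bsub>M\<^esub> x"
  by (simp_all add: frobenius_pushforward_def)

lemma finsum_frobenius_pushforward [simp]:
  "finsum (frobenius_pushforward R e M) f A = finsum M f A"
  by (simp add: finsum_def finprod_def)

lemma module_isomorphicE:
  assumes "module_isomorphic R M N"
  obtains f g where
    "\<And>x. x \<in> carrier M \<Longrightarrow> f x \<in> carrier N" "\<And>y. y \<in> carrier N \<Longrightarrow> g y \<in> carrier M"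
    "\<And>x. x \<in> carrier M \<Longrightarrow> g (f x) = x" "\<And>y. y \<in> carrier N \<Longrightarrow> f (g y) = y"
    "\<And>x y. \<lbrakk>x \<in> carrier M; y \<in> carrier M\<rbrakk> \<Longrightarrow> f (x \<oplus>\<^bsub>M\<^esub> y) = f x \<oplus>\<^bsub>N\<^esub> f y"
    "\<And>r x. \<lbrakk>r \<in> carrier R; x \<in> carrier M\<rbrakk> \<Longrightarrow> f (r \<odot>\<^bsub>M\<^esub> x) = r \<odot>\<^bsub>N\<^esub> f x"
proof -
  obtain f where f: "f \<in> iso (add_monoid M) (add_monoid N)"
    and s: "\<forall>r\<in>carrier R. \<forall>x\<in>carrier M. f (r \<odot>\<^bsub>M\<^esub> x) = r \<odot>\<^bsub>N\<^esub> f x"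
    using assms unfolding module_isomorphic_def by blast
  have bij: "bij_betw f (carrier M) (carrier N)" using f by (simp add: iso_def)
  show thesis
  proof (rule that[of f "inv_into (carrier M) f"])
    show "f x \<in> carrier N" if "x \<in> carrier M" for x using bij that by (rule bij_betwE[rule_format])
    show "inv_into (carrier M) f y \<in> carrier M" if "y \<in> carrier N" for y
      using bij that by (simp add: bij_betw_def inv_into_into)
    show "inv_into (carrier M) f (f x) = x" if "x \<in> carrier M" for x
      using bij that by (rule bij_betw_inv_into_left)
    show "f (inv_into (carrier M) f y) = y" if "y \<in> carrier N" for y
      using bij that by (rule bij_betw_inv_into_right)
    show "f (x \<oplus>\<^bsub>M\<^esub> y) = f x \<oplus>\<^bsub>N\<^esub> f y" if "x \<in> carrier M" "y \<in> carrier M" for x y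
      using f that by (simp add: iso_def hom_def)
    show "f (r \<odot>\<^bsub>M\<^esub> x) = r \<odot>\<^bsub>N\<^esub> f x" if "r \<in> carrier R" "x \<in> carrier M" for r x
      using s that by blast
  qed
qed

text \<open>
  The index set \<open>J\<close> is left arbitrary up to a bijection, so that the pairs can be replaced by the
  indices that the definition of FFRT prescribes.
\<close>

lemma finite_direct_sum_nested:
  assumes h: "bij_betw h J (B \<times> I)"
  shows "module_isomorphic R (finite_direct_sum B (\<lambda>_. finite_direct_sum I M))
    (finite_direct_sum J (\<lambda>x. M (snd (h x))))"
proof (rule module_isomorphicI[where f = "\<lambda>F. \<lambda>x\<in>J. F (fst (h x)) (snd (h x))"
      and g = "\<lambda>G. \<lambda>b\<in>B. \<lambda>i\<in>I. G (inv_into J h (b, i))"])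
  let ?h' = "inv_into J h"
  have h1: "fst (h x) \<in> B" "snd (h x) \<in> I" "?h' (h x) = x" if "x \<in> J" for x
    using bij_betwE[OF h] bij_betw_inv_into_left[OF h] that by (auto simp: mem_Times_iff)
  have h2: "?h' (b, i) \<in> J" "h (?h' (b, i)) = (b, i)" if "b \<in> B" "i \<in> I" for b i
    using bij_betw_inv_into_right[OF h, of "(b, i)"] bij_betwE[OF bij_betw_inv_into[OF h]] that
    by auto
  show "(\<lambda>x\<in>J. F (fst (h x)) (snd (h x))) \<in> carrier (finite_direct_sum J (\<lambda>x. M (snd (h x))))"
    "(\<lambda>b\<in>B. \<lambda>i\<in>I. (\<lambda>x\<in>J. F (fst (h x)) (snd (h x))) (?h' (b, i))) = F"
    if "F \<in> carrier (finite_direct_sum B (\<lambda>_. finite_direct_sum I M))" for F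
    using that h1 h2 by (auto simp: PiE_iff fun_eq_iff extensional_def)
  show "(\<lambda>b\<in>B. \<lambda>i\<in>I. G (?h' (b, i))) \<in> carrier (finite_direct_sum B (\<lambda>_. finite_direct_sum I M))"
    "(\<lambda>x\<in>J. (\<lambda>b\<in>B. \<lambda>i\<in>I. G (?h' (b, i))) (fst (h x)) (snd (h x))) = G"
    if "G \<in> carrier (finite_direct_sum J (\<lambda>x. M (snd (h x))))" for G
    using that h1 h2 by (auto simp: PiE_iff fun_eq_iff extensional_def) (metis snd_conv)
  show "(\<lambda>x\<in>J. (F \<oplus>\<^bsub>finite_direct_sum B (\<lambda>_. finite_direct_sum I M)\<^esub> G) (fst (h x)) (snd (h x)))
      = (\<lambda>x\<in>J. F (fst (h x)) (snd (h x))) \<oplus>\<^bsub>finite_direct_sum J (\<lambda>x. M (snd (h x)))\<^esub>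
        (\<lambda>x\<in>J. G (fst (h x)) (snd (h x)))" for F G
    using h1 by (simp cong: restrict_cong)
  show "(\<lambda>x\<in>J. (r \<odot>\<^bsub>finite_direct_sum B (\<lambda>_. finite_direct_sum I M)\<^esub> F) (fst (h x)) (snd (h x)))
      = r \<odot>\<^bsub>finite_direct_sum J (\<lambda>x. M (snd (h x)))\<^esub> (\<lambda>x\<in>J. F (fst (h x)) (snd (h x)))" for r F
    using h1 by (simp cong: restrict_cong)
qed

lemma additive_zero:
  assumes "abelian_group M" "abelian_group N"
    and u: "\<And>x. x \<in> carrier M \<Longrightarrow> u x \<in> carrier N"
    and add: "\<And>x y. \<lbrakk>x \<in> carrier M; y \<in> carrier M\<rbrakk> \<Longrightarrow> u (x \<oplus>\<^bsub>M\<^esub> y) = u x \<oplus>\<^bsub>N\<^esub> u y"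
  shows "u \<zero>\<^bsub>M\<^esub> = \<zero>\<^bsub>N\<^esub>"
proof -
  interpret M: abelian_group M by fact
  interpret N: abelian_group N by fact
  show ?thesis
    using add[of "\<zero>\<^bsub>M\<^esub>" "\<zero>\<^bsub>M\<^esub>"] u[of "\<zero>\<^bsub>M\<^esub>"] by (simp add: N.add.r_cancel_one')
qed

lemma additive_finsum:
  assumes M: "abelian_group M" and N: "abelian_group N"
    and u: "\<And>x. x \<in> carrier M \<Longrightarrow> u x \<in> carrier N"
    and add: "\<And>x y. \<lbrakk>x \<in> carrier M; y \<in> carrier M\<rbrakk> \<Longrightarrow> u (x \<oplus>\<^bsub>M\<^esub> y) = u x \<oplus>\<^bsub>N\<^esub> u y"
    and "finite A" and "f \<in> A \<rightarrow> carrier M"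
  shows "u (\<Oplus>\<^bsub>M\<^esub>a\<in>A. f a) = (\<Oplus>\<^bsub>N\<^esub>a\<in>A. u (f a))"
proof -
  interpret M: abelian_group M by fact
  interpret N: abelian_group N by fact
  show ?thesis
    using assms(5,6)
  proof (induction A)
    case (insert a A)
    then have "f a \<in> carrier M" "f \<in> A \<rightarrow> carrier M" by auto
    moreover from this have "(\<lambda>a. u (f a)) \<in> A \<rightarrow> carrier N" using u by blast
    ultimately show ?case using insert by (simp add: add u)
  qed (simp add: additive_zero[OF M N u add])
qed

text \<open>
  The index set of \<open>card B\<close> copies of a direct sum with multiplicities \<open>t j\<close> is that of the direct
  sum with multiplicities \<open>card B * t j\<close>: division by \<open>t j\<close> tells in which copy a position lies and
  where in that copy.
\<close>

lemma bij_betw_copies: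
  fixes t :: "nat \<Rightarrow> nat"
  assumes "finite B"
  obtains h where "bij_betw h {(j, k). j < n \<and> k < card B * t j} (B \<times> {(j, k). j < n \<and> k < t j})"
    and "\<And>x. fst (snd (h x)) = fst x"
proof -
  obtain \<beta> where \<beta>: "bij_betw \<beta> {..<card B} B"
    using ex_bij_betw_nat_finite[OF assms] by (auto simp: atLeast0LessThan)
  define \<beta>' where "\<beta>' = inv_into {..<card B} \<beta>"
  have \<beta>': "\<beta>' b < card B" "\<beta> (\<beta>' b) = b" if "b \<in> B" for b
    using bij_betw_inv_into_right[OF \<beta> that] bij_betwE[OF bij_betw_inv_into[OF \<beta>]] that
    by (auto simp: \<beta>'_def)
  have \<beta>'\<beta>: "\<beta>' (\<beta> i) = i" if "i < card B" for i
    using bij_betw_inv_into_left[OF \<beta>] that by (simp add: \<beta>'_def)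
  let ?h = "\<lambda>x. (\<beta> (snd x div t (fst x)), fst x, snd x mod t (fst x))"
  let ?g = "\<lambda>y. (fst (snd y), \<beta>' (fst y) * t (fst (snd y)) + snd (snd y))"
  have less: "i * m + k < c * m" if "i < c" "k < m" for i m k c :: nat
  proof -
    have "i * m + k < Suc i * m" using that by simp
    also have "\<dots> \<le> c * m" using that by (intro mult_le_mono1) simp
    finally show ?thesis .
  qed
  have "bij_betw ?h {(j, k). j < n \<and> k < card B * t j} (B \<times> {(j, k). j < n \<and> k < t j})"
  proof (rule bij_betw_byWitness[where f' = ?g]; clarsimp)
    fix j k assume k: "k < card B * t j"
    then have "0 < t j" by (cases "t j") auto
    moreover from k have d: "k div t j < card B" by (simp add: less_mult_imp_div_less)
    ultimately show "\<beta>' (\<beta> (k div t j)) * t j + k mod t j = k"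
      and "\<beta> (k div t j) \<in> B \<and> k mod t j < t j"
      using bij_betwE[OF \<beta>] by (simp_all add: \<beta>'\<beta>)
  qed (use \<beta>' less in auto)
  then show thesis by (rule that) simp
qed

lemma finite_direct_sum_cong:
  assumes "\<And>i. i \<in> I \<Longrightarrow> M i = N i"
  shows "finite_direct_sum I M = finite_direct_sum I N"
  using assms by (simp add: finite_direct_sum_def cong: PiE_cong restrict_cong)

lemma module_finite_direct_sum:
  assumes "cring R" and M: "\<And>i. i \<in> I \<Longrightarrow> module R (M i)"
  shows "module R (finite_direct_sum I M)"
proof (rule moduleI)
  let ?D = "finite_direct_sum I M"
  have ag: "abelian_group (M i)" if "i \<in> I" for i using M[OF that] by (simp add: module_def)
  note am = ag[THEN abelian_group.axioms(1)]
  show "cring R" by fact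
  show "abelian_group ?D"
  proof (rule abelian_groupI)
    fix x y assume "x \<in> carrier ?D" "y \<in> carrier ?D"
    then show "x \<oplus>\<^bsub>?D\<^esub> y \<in> carrier ?D" "x \<oplus>\<^bsub>?D\<^esub> y = y \<oplus>\<^bsub>?D\<^esub> x"
      by (auto simp: PiE_iff abelian_monoid.a_closed[OF am] abelian_monoid.a_comm[OF am] intro!: restrict_ext)
  next
    fix x y z assume "x \<in> carrier ?D" "y \<in> carrier ?D" "z \<in> carrier ?D"
    then show "(x \<oplus>\<^bsub>?D\<^esub> y) \<oplus>\<^bsub>?D\<^esub> z = x \<oplus>\<^bsub>?D\<^esub> (y \<oplus>\<^bsub>?D\<^esub> z)"
      by (auto simp: PiE_iff abelian_monoid.a_assoc[OF am] intro!: restrict_ext)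
  next
    show "\<zero>\<^bsub>?D\<^esub> \<in> carrier ?D" by (simp add: abelian_monoid.zero_closed[OF am])
  next
    fix x assume x: "x \<in> carrier ?D"
    then show "\<zero>\<^bsub>?D\<^esub> \<oplus>\<^bsub>?D\<^esub> x = x"
      by (auto simp: PiE_iff fun_eq_iff extensional_def abelian_monoid.l_zero[OF am])
    show "\<exists>y\<in>carrier ?D. y \<oplus>\<^bsub>?D\<^esub> x = \<zero>\<^bsub>?D\<^esub>"
      using x by (intro bexI[of _ "\<lambda>i\<in>I. \<ominus>\<^bsub>M i\<^esub> x i"])
        (auto simp: PiE_iff abelian_group.l_neg[OF ag] abelian_group.a_inv_closed[OF ag] intro!: restrict_ext)
  qed
qed (auto simp: PiE_iff fun_eq_iff extensional_def module.smult_closed[OF M] module.smult_l_distr[OF M]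
    module.smult_r_distr[OF M] module.smult_assoc1[OF M] module.smult_one[OF M])

section \<open>Series with coefficients in a module\<close>

text \<open>
  Exponents form an additive monoid that need not be a semiring, so \<open>q k\<close> is a repeated sum.
\<close>

primrec multiple :: "nat \<Rightarrow> 'k::comm_monoid_add \<Rightarrow> 'k" where
  "multiple 0 k = 0"
| "multiple (Suc q) k = k + multiple q k"

lemma multiple_add: "multiple q (k + l) = multiple q k + multiple q l"
  by (induction q) (simp_all add: ac_simps)

lemma multiple_add_left: "multiple (q + r) k = multiple q k + multiple r k"
  by (induction q) (simp_all add: ac_simps)

lemma multiple_multiple: "multiple q (multiple r k) = multiple (q * r) k"
  by (induction q) (simp_all add: multiple_add_left)

definition factorizations :: "'k::plus \<Rightarrow> ('k \<times> 'k) set" where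
  "factorizations m = {(i, j). i + j = m}"

lemma mem_factorizations: "x \<in> factorizations m \<longleftrightarrow> fst x + snd x = m"
  by (auto simp: factorizations_def)

text \<open>
  The product of a series \<open>r\<close> over the ring and a series \<open>f\<close> over the module. Multiplication of
  two series over \<open>R\<close> is the case of the module \<open>R\<close> itself, so that the laws below serve the ring
  and its modules alike.
\<close>

definition convolution ::
    "('a, 'b, 'n) module_scheme \<Rightarrow> ('k::plus \<Rightarrow> 'a) \<Rightarrow> ('k \<Rightarrow> 'b) \<Rightarrow> 'k \<Rightarrow> 'b" where
  "convolution M r f m = (\<Oplus>\<^bsub>M\<^esub>x\<in>factorizations m. r (fst x) \<odot>\<^bsub>M\<^esub> f (snd x))"

text \<open>
  With \<open>fin\<close> these are the polynomials, without it the power series. Families are total, so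
  coefficients outside the set \<open>K\<close> of admissible exponents are required to vanish.
\<close>

definition series ::
    "bool \<Rightarrow> 'k set \<Rightarrow> ('b, 'n) ring_scheme \<Rightarrow> ('k \<Rightarrow> 'b) set" where
  "series fin K M = {f. (\<forall>m. f m \<in> carrier M) \<and> (\<forall>m. m \<notin> K \<longrightarrow> f m = \<zero>\<^bsub>M\<^esub>) \<and>
     (fin \<longrightarrow> finite {m. f m \<noteq> \<zero>\<^bsub>M\<^esub>})}"

definition series_module ::
    "bool \<Rightarrow> 'k::plus set \<Rightarrow> ('a, 'b, 'n) module_scheme \<Rightarrow> ('k \<Rightarrow> 'a, 'k \<Rightarrow> 'b) module" where
  "series_module fin K M =
     \<lparr>carrier = series fin K M, monoid.mult = undefined, one = undefined,
      ring.zero = (\<lambda>m. \<zero>\<^bsub>M\<^esub>), ring.add = (\<lambda>f g m. f m \<oplus>\<^bsub>M\<^esub> g m),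
      smult = convolution M\<rparr>"

lemma series_module_simps [simp]:
  "carrier (series_module fin K M) = series fin K M"
  "\<zero>\<^bsub>series_module fin K M\<^esub> = (\<lambda>m. \<zero>\<^bsub>M\<^esub>)"
  "f \<oplus>\<^bsub>series_module fin K M\<^esub> g = (\<lambda>m. f m \<oplus>\<^bsub>M\<^esub> g m)"
  "r \<odot>\<^bsub>series_module fin K M\<^esub> f = convolution M r f"
  by (simp_all add: series_module_def)

lemma self_module_simps [simp]:
  "carrier (self_module R) = carrier R" "\<zero>\<^bsub>self_module R\<^esub> = \<zero>\<^bsub>R\<^esub>"
  "add (self_module R) = add R" "smult (self_module R) = monoid.mult R"
  "finsum (self_module R) f A = finsum R f A" "series fin K (self_module R) = series fin K R"
  by (simp_all add: self_module_def finsum_def finprod_def series_def)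

lemma seriesI:
  assumes "\<And>m. f m \<in> carrier M" "\<And>m. m \<notin> K \<Longrightarrow> f m = \<zero>\<^bsub>M\<^esub>"
    and "fin \<Longrightarrow> finite {m. f m \<noteq> \<zero>\<^bsub>M\<^esub>}"
  shows "f \<in> series fin K M"
  using assms by (simp add: series_def)

lemma seriesD:
  assumes "f \<in> series fin K M"
  shows "f m \<in> carrier M" "m \<notin> K \<Longrightarrow> f m = \<zero>\<^bsub>M\<^esub>" "fin \<Longrightarrow> finite {m. f m \<noteq> \<zero>\<^bsub>M\<^esub>}"
  using assms by (simp_all add: series_def)

text \<open>
  Closure under sums makes products of series vanish off \<open>K\<close>; closure under summands keeps all
  decompositions of an element of \<open>K\<close> inside \<open>K\<close>. In the last condition \<open>B\<close> is a set of remainders modulo \<open>q\<close>.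
\<close>

locale monomials =
  fixes K :: "'k::cancel_comm_monoid_add set"
  assumes zero_mem [simp]: "0 \<in> K"
    and add_mem_iff: "i + j \<in> K \<longleftrightarrow> i \<in> K \<and> j \<in> K"
    and finite_factorizations [simp]: "\<And>m :: 'k. finite (factorizations m)"
    and division: "0 < q \<Longrightarrow>
      \<exists>B. finite B \<and> bij_betw (\<lambda>x. fst x + multiple q (snd x)) (B \<times> K) K"
begin

lemma multiple_mem [simp]: "k \<in> K \<Longrightarrow> multiple q k \<in> K"
  by (induction q) (simp_all add: add_mem_iff)

lemma multiple_mem_iff: "0 < q \<Longrightarrow> multiple q k \<in> K \<longleftrightarrow> k \<in> K"
  by (cases q) (auto simp: add_mem_iff)

lemma multiple_inject:
  assumes "0 < q" "k \<in> K" "l \<in> K"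
  shows "multiple q k = multiple q l \<longleftrightarrow> k = l"
proof -
  obtain B where B: "finite B" "bij_betw (\<lambda>x. fst x + multiple q (snd x)) (B \<times> K) K"
    using division[OF assms(1)] by blast
  have "B \<noteq> {}" using bij_betw_imp_surj_on[OF B(2)] zero_mem by fastforce
  then obtain b where b: "b \<in> B" by blast
  show ?thesis
    using inj_onD[OF bij_betw_imp_inj_on[OF B(2)], of "(b, k)" "(b, l)"] b assms by auto
qed

context
  fixes R :: "('a, 'm) ring_scheme" and M :: "('a, 'b, 'n) module_scheme"
  assumes M: "module R M"
begin

interpretation M: module R M by (rule M)

lemma convolution_coeff_closed:
  assumes "\<And>m. r m \<in> carrier R" "\<And>m. f m \<in> carrier M"
  shows "convolution M r f m \<in> carrier M"
  unfolding convolution_def using assms by (intro M.M.finsum_closed) auto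

lemma convolution_add_left:
  assumes "\<And>m. r m \<in> carrier R" "\<And>m. s m \<in> carrier R" "\<And>m. f m \<in> carrier M"
  shows "convolution M (\<lambda>m. r m \<oplus>\<^bsub>R\<^esub> s m) f = (\<lambda>m. convolution M r f m \<oplus>\<^bsub>M\<^esub> convolution M s f m)"
  unfolding convolution_def fun_eq_iff using assms
  by (simp add: M.smult_l_distr Pi_def flip: M.M.finsum_addf)

lemma convolution_add_right:
  assumes "\<And>m. r m \<in> carrier R" "\<And>m. f m \<in> carrier M" "\<And>m. g m \<in> carrier M"
  shows "convolution M r (\<lambda>m. f m \<oplus>\<^bsub>M\<^esub> g m) = (\<lambda>m. convolution M r f m \<oplus>\<^bsub>M\<^esub> convolution M r g m)"
  unfolding convolution_def fun_eq_iff using assms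
  by (simp add: M.smult_r_distr Pi_def flip: M.M.finsum_addf)

lemma convolution_constant_left:
  fixes f :: "'k \<Rightarrow> 'b"
  assumes "a \<in> carrier R" "\<And>m. f m \<in> carrier M"
  shows "convolution M (\<lambda>m. if m = 0 then a else \<zero>\<^bsub>R\<^esub>) f = (\<lambda>m. a \<odot>\<^bsub>M\<^esub> f m)"
proof
  fix m :: 'k
  show "convolution M (\<lambda>m. if m = 0 then a else \<zero>\<^bsub>R\<^esub>) f m = a \<odot>\<^bsub>M\<^esub> f m"
    unfolding convolution_def using assms
    by (subst M.M.finsum_eq_single[where a = "(0, m)"]) (auto simp: mem_factorizations prod_eq_iff)
qed

lemma convolution_constant_right:
  fixes r :: "'k \<Rightarrow> 'a"
  assumes "\<And>m. r m \<in> carrier R" "x \<in> carrier M"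
  shows "convolution M r (\<lambda>m. if m = 0 then x else \<zero>\<^bsub>M\<^esub>) = (\<lambda>m. r m \<odot>\<^bsub>M\<^esub> x)"
proof
  fix m :: 'k
  show "convolution M r (\<lambda>m. if m = 0 then x else \<zero>\<^bsub>M\<^esub>) m = r m \<odot>\<^bsub>M\<^esub> x"
    unfolding convolution_def using assms
    by (subst M.M.finsum_eq_single[where a = "(m, 0)"]) (auto simp: mem_factorizations prod_eq_iff)
qed

text \<open>
  Both sides are the sum over all decompositions \<open>m = i + j + l\<close>.
\<close>

lemma convolution_assoc:
  fixes r s :: "'k \<Rightarrow> 'a" and f :: "'k \<Rightarrow> 'b"
  assumes r: "\<And>m. r m \<in> carrier R" and s: "\<And>m. s m \<in> carrier R" and f: "\<And>m. f m \<in> carrier M"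
  shows "convolution M (convolution (self_module R) r s) f = convolution M r (convolution M s f)"
proof
  fix m :: 'k
  let ?F = "factorizations :: 'k \<Rightarrow> ('k \<times> 'k) set"
  define T where "T = {(i, j, l). i + j + l = m}"
  define t where "t x = (case x of (i, j, l) \<Rightarrow> r i \<odot>\<^bsub>M\<^esub> (s j \<odot>\<^bsub>M\<^esub> f l))" for x
  have t: "t x \<in> carrier M" for x using r s f by (simp add: t_def split: prod.split)
  have "convolution M (convolution (self_module R) r s) f m
      = (\<Oplus>\<^bsub>M\<^esub>x\<in>?F m. \<Oplus>\<^bsub>M\<^esub>y\<in>?F (fst x). t (fst y, snd y, snd x))"
    unfolding convolution_def using r s f
    by (intro M.M.finsum_cong')
      (auto simp: t_def M.smult_assoc1 M.finsum_smult_rdistr intro!: M.M.finsum_cong' M.M.finsum_closed)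
  also have "\<dots> = (\<Oplus>\<^bsub>M\<^esub>z\<in>(SIGMA x : ?F m. ?F (fst x)). t (fst (snd z), snd (snd z), snd (fst z)))"
    using t by (intro M.M.finsum_Sigma) auto
  also have "(SIGMA x : ?F m. ?F (fst x)) = (\<lambda>(i, j, l). ((i + j, l), (i, j))) ` T"
    by (force simp: factorizations_def T_def)
  also have "(\<Oplus>\<^bsub>M\<^esub>z\<in>(\<lambda>(i, j, l). ((i + j, l), (i, j))) ` T. t (fst (snd z), snd (snd z), snd (fst z)))
      = (\<Oplus>\<^bsub>M\<^esub>x\<in>T. t x)"
    using t by (subst M.M.add.finprod_reindex) (auto simp: inj_on_def split_def)
  finally have L: "convolution M (convolution (self_module R) r s) f m = (\<Oplus>\<^bsub>M\<^esub>x\<in>T. t x)" .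
  have "convolution M r (convolution M s f) m
      = (\<Oplus>\<^bsub>M\<^esub>x\<in>?F m. \<Oplus>\<^bsub>M\<^esub>y\<in>?F (snd x). t (fst x, fst y, snd y))"
    unfolding convolution_def using r s f
    by (intro M.M.finsum_cong')
      (auto simp: t_def M.finsum_smult_ldistr intro!: M.M.finsum_cong' M.M.finsum_closed)
  also have "\<dots> = (\<Oplus>\<^bsub>M\<^esub>z\<in>(SIGMA x : ?F m. ?F (snd x)). t (fst (fst z), fst (snd z), snd (snd z)))"
    using t by (intro M.M.finsum_Sigma) auto
  also have "(SIGMA x : ?F m. ?F (snd x)) = (\<lambda>(i, j, l). ((i, j + l), (j, l))) ` T"
    by (force simp: factorizations_def T_def ac_simps)
  also have "(\<Oplus>\<^bsub>M\<^esub>z\<in>(\<lambda>(i, j, l). ((i, j + l), (j, l))) ` T. t (fst (fst z), fst (snd z), snd (snd z)))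
      = (\<Oplus>\<^bsub>M\<^esub>x\<in>T. t x)"
    using t by (subst M.M.add.finprod_reindex) (auto simp: inj_on_def split_def)
  finally show "convolution M (convolution (self_module R) r s) f m
      = convolution M r (convolution M s f) m" using L by simp
qed

lemma convolution_eq_zero:
  assumes "\<And>i j. i + j = m \<Longrightarrow> r i = \<zero>\<^bsub>R\<^esub> \<or> f j = \<zero>\<^bsub>M\<^esub>"
    and "\<And>m. r m \<in> carrier R" "\<And>m. f m \<in> carrier M"
  shows "convolution M r f m = \<zero>\<^bsub>M\<^esub>"
  unfolding convolution_def
proof (rule M.M.add.finprod_one_eqI)
  fix x assume "x \<in> factorizations m"
  then have "fst x + snd x = m" by (auto simp: factorizations_def)
  from assms(1)[OF this] show "r (fst x) \<odot>\<^bsub>M\<^esub> f (snd x) = \<zero>\<^bsub>M\<^esub>"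
    using assms(2,3) by auto
qed

lemma convolution_closed:
  assumes r: "r \<in> series fin K R" and f: "f \<in> series fin K M"
  shows "convolution M r f \<in> series fin K M"
proof (rule seriesI)
  note [simp] = seriesD(1)[OF r] seriesD(1)[OF f]
  show "convolution M r f m \<in> carrier M" for m by (simp add: convolution_coeff_closed)
  show "convolution M r f m = \<zero>\<^bsub>M\<^esub>" if "m \<notin> K" for m
    using that seriesD(2)[OF r] seriesD(2)[OF f]
    by (intro convolution_eq_zero) (auto simp: add_mem_iff)
  assume fin
  let ?A = "{m. r m \<noteq> \<zero>\<^bsub>R\<^esub>}" and ?B = "{m. f m \<noteq> \<zero>\<^bsub>M\<^esub>}"
  have "finite ((\<lambda>(i, j). i + j) ` (?A \<times> ?B))"
    using seriesD(3)[OF r] seriesD(3)[OF f] \<open>fin\<close> by blast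
  moreover have "m \<in> (\<lambda>(i, j). i + j) ` (?A \<times> ?B)" if "convolution M r f m \<noteq> \<zero>\<^bsub>M\<^esub>" for m
    using convolution_eq_zero[of m r f] that by (auto simp: image_iff)
  ultimately show "finite {m. convolution M r f m \<noteq> \<zero>\<^bsub>M\<^esub>}"
    by (elim rev_finite_subset) blast
qed

lemma zero_closed_series: "(\<lambda>m. \<zero>\<^bsub>M\<^esub>) \<in> series fin K M"
  by (rule seriesI) simp_all

lemma add_closed_series:
  assumes f: "f \<in> series fin K M" and g: "g \<in> series fin K M"
  shows "(\<lambda>m. f m \<oplus>\<^bsub>M\<^esub> g m) \<in> series fin K M"
proof (rule seriesI)
  show "f m \<oplus>\<^bsub>M\<^esub> g m \<in> carrier M" for m
    using seriesD(1)[OF f] seriesD(1)[OF g] by simp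
  show "f m \<oplus>\<^bsub>M\<^esub> g m = \<zero>\<^bsub>M\<^esub>" if "m \<notin> K" for m
    using seriesD(2)[OF f that] seriesD(2)[OF g that] by simp
  assume fin
  show "finite {m. f m \<oplus>\<^bsub>M\<^esub> g m \<noteq> \<zero>\<^bsub>M\<^esub>}"
  proof (rule finite_subset)
    show "{m. f m \<oplus>\<^bsub>M\<^esub> g m \<noteq> \<zero>\<^bsub>M\<^esub>} \<subseteq> {m. f m \<noteq> \<zero>\<^bsub>M\<^esub>} \<union> {m. g m \<noteq> \<zero>\<^bsub>M\<^esub>}"
      by auto
    show "finite ({m. f m \<noteq> \<zero>\<^bsub>M\<^esub>} \<union> {m. g m \<noteq> \<zero>\<^bsub>M\<^esub>})"
      using seriesD(3)[OF f \<open>fin\<close>] seriesD(3)[OF g \<open>fin\<close>] by (rule finite_UnI)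
  qed
qed

lemma a_inv_closed_series:
  assumes f: "f \<in> series fin K M"
  shows "(\<lambda>m. \<ominus>\<^bsub>M\<^esub> f m) \<in> series fin K M"
proof (rule seriesI)
  show "\<ominus>\<^bsub>M\<^esub> f m \<in> carrier M" for m using seriesD(1)[OF f] by simp
  show "\<ominus>\<^bsub>M\<^esub> f m = \<zero>\<^bsub>M\<^esub>" if "m \<notin> K" for m using seriesD(2)[OF f that] by simp
  assume fin
  show "finite {m. \<ominus>\<^bsub>M\<^esub> f m \<noteq> \<zero>\<^bsub>M\<^esub>}"
    by (rule finite_subset[OF _ seriesD(3)[OF f \<open>fin\<close>]]) auto
qed

lemma abelian_group_series_module: "abelian_group (series_module fin K M)"
proof (rule abelian_groupI, simp_all only: series_module_simps)
  fix f g assume f: "f \<in> series fin K M" and g: "g \<in> series fin K M"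
  show "(\<lambda>m. f m \<oplus>\<^bsub>M\<^esub> g m) \<in> series fin K M" by (rule add_closed_series[OF f g])
  show "(\<lambda>m. f m \<oplus>\<^bsub>M\<^esub> g m) = (\<lambda>m. g m \<oplus>\<^bsub>M\<^esub> f m)"
    using seriesD(1)[OF f] seriesD(1)[OF g] by (simp add: M.M.a_comm)
next
  fix f g h assume fgh: "f \<in> series fin K M" "g \<in> series fin K M" "h \<in> series fin K M"
  show "(\<lambda>m. f m \<oplus>\<^bsub>M\<^esub> g m \<oplus>\<^bsub>M\<^esub> h m) = (\<lambda>m. f m \<oplus>\<^bsub>M\<^esub> (g m \<oplus>\<^bsub>M\<^esub> h m))"
    using fgh[THEN seriesD(1)] by (simp add: M.M.a_assoc)
next
  fix f assume f: "f \<in> series fin K M"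
  show "(\<lambda>m. \<zero>\<^bsub>M\<^esub> \<oplus>\<^bsub>M\<^esub> f m) = f" using seriesD(1)[OF f] by simp
  have "(\<lambda>m. \<ominus>\<^bsub>M\<^esub> f m \<oplus>\<^bsub>M\<^esub> f m) = (\<lambda>m. \<zero>\<^bsub>M\<^esub>)"
    using seriesD(1)[OF f] by (simp add: M.M.l_neg)
  then show "\<exists>g\<in>series fin K M. (\<lambda>m. g m \<oplus>\<^bsub>M\<^esub> f m) = (\<lambda>m. \<zero>\<^bsub>M\<^esub>)"
    by (rule bexI[OF _ a_inv_closed_series[OF f]])
qed (rule zero_closed_series)

end
end

text \<open>
  The ring operations are prescribed on the carrier only: the library's \<^const>\<open>UP\<close> leaves them
  unspecified elsewhere.
\<close>

locale series_ring = monomials K + R?: cring R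
  for K :: "'k::cancel_comm_monoid_add set" and R :: "('a, 'm) ring_scheme" +
  fixes fin :: bool and S :: "('k \<Rightarrow> 'a, 'l) ring_scheme"
  assumes carrier_S: "carrier S = series fin K R"
    and zero_S: "\<zero>\<^bsub>S\<^esub> = (\<lambda>m. \<zero>\<^bsub>R\<^esub>)"
    and one_S: "\<one>\<^bsub>S\<^esub> = (\<lambda>m. if m = 0 then \<one>\<^bsub>R\<^esub> else \<zero>\<^bsub>R\<^esub>)"
    and add_S: "\<lbrakk>f \<in> carrier S; g \<in> carrier S\<rbrakk> \<Longrightarrow> f \<oplus>\<^bsub>S\<^esub> g = (\<lambda>m. f m \<oplus>\<^bsub>R\<^esub> g m)"
    and mult_S: "\<lbrakk>f \<in> carrier S; g \<in> carrier S\<rbrakk> \<Longrightarrow> f \<otimes>\<^bsub>S\<^esub> g = convolution (self_module R) f g"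
begin

lemma self: "module R (self_module R)"
  by (rule module_self_module) (rule is_cring)

lemma convolution_commute:
  fixes f g :: "'k \<Rightarrow> 'a"
  assumes "\<And>m. f m \<in> carrier R" "\<And>m. g m \<in> carrier R"
  shows "convolution (self_module R) f g = convolution (self_module R) g f"
proof
  fix m :: 'k
  have swap: "prod.swap ` factorizations m = factorizations m"
    by (auto simp: factorizations_def image_iff add.commute)
  have "convolution (self_module R) f g m
      = (\<Oplus>\<^bsub>R\<^esub>x\<in>prod.swap ` factorizations m. f (fst x) \<otimes>\<^bsub>R\<^esub> g (snd x))"
    by (simp add: convolution_def swap)
  also have "\<dots> = (\<Oplus>\<^bsub>R\<^esub>x\<in>factorizations m. f (fst (prod.swap x)) \<otimes>\<^bsub>R\<^esub> g (snd (prod.swap x)))"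
    using assms by (intro add.finprod_reindex) auto
  also have "\<dots> = convolution (self_module R) g f m"
    using assms by (simp add: convolution_def m_comm)
  finally show "convolution (self_module R) f g m = convolution (self_module R) g f m" .
qed

lemma constant_closed: "a \<in> carrier R \<Longrightarrow> (\<lambda>m. if m = 0 then a else \<zero>\<^bsub>R\<^esub>) \<in> carrier S"
  unfolding carrier_S by (rule seriesI) auto

lemma coeff_closed [simp]: "f \<in> carrier S \<Longrightarrow> f m \<in> carrier R"
  unfolding carrier_S by (rule seriesD)

lemma mult_closed_S: "\<lbrakk>f \<in> carrier S; g \<in> carrier S\<rbrakk> \<Longrightarrow> f \<otimes>\<^bsub>S\<^esub> g \<in> carrier S"
  using convolution_closed[OF self, of f fin g] mult_S[of f g] by (simp add: carrier_S)

lemma cring_S: "cring S"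
proof (rule cringI)
  interpret A: abelian_group "series_module fin K (self_module R)"
    by (rule abelian_group_series_module) (rule self)
  show "abelian_group S"
  proof (rule abelian_groupI)
    fix f assume "f \<in> carrier S"
    then show "\<exists>g\<in>carrier S. g \<oplus>\<^bsub>S\<^esub> f = \<zero>\<^bsub>S\<^esub>"
      using A.add.l_inv_ex[of f] add_S by (auto simp: carrier_S zero_S)
  next
    fix f g assume fg: "f \<in> carrier S" "g \<in> carrier S"
    then show "f \<oplus>\<^bsub>S\<^esub> g \<in> carrier S"
      using A.a_closed[of f g] add_S[of f g] by (simp add: carrier_S)
    show "f \<oplus>\<^bsub>S\<^esub> g = g \<oplus>\<^bsub>S\<^esub> f"
      using fg by (simp add: add_S a_comm)
  next
    fix f g h assume fgh: "f \<in> carrier S" "g \<in> carrier S" "h \<in> carrier S"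
    have "f \<oplus>\<^bsub>S\<^esub> g \<in> carrier S" "g \<oplus>\<^bsub>S\<^esub> h \<in> carrier S"
      using fgh A.a_closed[of f g] A.a_closed[of g h] add_S by (simp_all add: carrier_S)
    then show "(f \<oplus>\<^bsub>S\<^esub> g) \<oplus>\<^bsub>S\<^esub> h = f \<oplus>\<^bsub>S\<^esub> (g \<oplus>\<^bsub>S\<^esub> h)"
      using fgh by (simp add: add_S a_assoc)
  next
    show "\<zero>\<^bsub>S\<^esub> \<in> carrier S" using A.zero_closed by (simp add: carrier_S zero_S)
    then show "\<zero>\<^bsub>S\<^esub> \<oplus>\<^bsub>S\<^esub> f = f" if "f \<in> carrier S" for f
      using that by (simp add: add_S) (simp add: zero_S)
  qed
  show "comm_monoid S"
  proof (rule comm_monoidI)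
    show one: "\<one>\<^bsub>S\<^esub> \<in> carrier S" by (simp add: one_S constant_closed)
    show "f \<otimes>\<^bsub>S\<^esub> g \<in> carrier S" if "f \<in> carrier S" "g \<in> carrier S" for f g
      using that by (rule mult_closed_S)
    show "\<one>\<^bsub>S\<^esub> \<otimes>\<^bsub>S\<^esub> f = f" if "f \<in> carrier S" for f
      using that one convolution_constant_left[OF self, of "\<one>\<^bsub>R\<^esub>" f]
      by (simp add: mult_S) (simp add: one_S)
    show "f \<otimes>\<^bsub>S\<^esub> g = g \<otimes>\<^bsub>S\<^esub> f" if "f \<in> carrier S" "g \<in> carrier S" for f g
      using that by (simp add: mult_S convolution_commute)
    show "(f \<otimes>\<^bsub>S\<^esub> g) \<otimes>\<^bsub>S\<^esub> h = f \<otimes>\<^bsub>S\<^esub> (g \<otimes>\<^bsub>S\<^esub> h)"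
      if "f \<in> carrier S" "g \<in> carrier S" "h \<in> carrier S" for f g h
      using that mult_closed_S[of f g] mult_closed_S[of g h]
      by (simp add: mult_S convolution_assoc[OF self])
  qed
  fix f g h assume fgh: "f \<in> carrier S" "g \<in> carrier S" "h \<in> carrier S"
  have "f \<oplus>\<^bsub>S\<^esub> g \<in> carrier S"
    using fgh A.a_closed[of f g] add_S[of f g] by (simp add: carrier_S)
  then show "(f \<oplus>\<^bsub>S\<^esub> g) \<otimes>\<^bsub>S\<^esub> h = f \<otimes>\<^bsub>S\<^esub> h \<oplus>\<^bsub>S\<^esub> g \<otimes>\<^bsub>S\<^esub> h"
    using fgh mult_closed_S[of f h] mult_closed_S[of g h] convolution_add_left[OF self, of f g h]
    by (simp add: mult_S add_S)
qed

sublocale S: cring S by (rule cring_S)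

lemma module_series_module:
  assumes M: "module R M"
  shows "module S (series_module fin K M)"
proof (rule moduleI)
  show "cring S" ..
  show "abelian_group (series_module fin K M)" by (rule abelian_group_series_module[OF M])
  interpret M: module R M by (rule M)
  let ?P = "series_module fin K M"
  have [simp]: "f m \<in> carrier M" if "f \<in> series fin K M" for f m using that by (rule seriesD)
  show "r \<odot>\<^bsub>?P\<^esub> f \<in> carrier ?P" if "r \<in> carrier S" "f \<in> carrier ?P" for r f
    using that convolution_closed[OF M] by (simp add: carrier_S)
  show "(r \<oplus>\<^bsub>S\<^esub> s) \<odot>\<^bsub>?P\<^esub> f = r \<odot>\<^bsub>?P\<^esub> f \<oplus>\<^bsub>?P\<^esub> s \<odot>\<^bsub>?P\<^esub> f"
    if "r \<in> carrier S" "s \<in> carrier S" "f \<in> carrier ?P" for r s f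
    using that by (simp add: add_S convolution_add_left[OF M])
  show "r \<odot>\<^bsub>?P\<^esub> (f \<oplus>\<^bsub>?P\<^esub> g) = r \<odot>\<^bsub>?P\<^esub> f \<oplus>\<^bsub>?P\<^esub> r \<odot>\<^bsub>?P\<^esub> g"
    if "r \<in> carrier S" "f \<in> carrier ?P" "g \<in> carrier ?P" for r f g
    using that by (simp add: convolution_add_right[OF M])
  show "(r \<otimes>\<^bsub>S\<^esub> s) \<odot>\<^bsub>?P\<^esub> f = r \<odot>\<^bsub>?P\<^esub> (s \<odot>\<^bsub>?P\<^esub> f)"
    if "r \<in> carrier S" "s \<in> carrier S" "f \<in> carrier ?P" for r s f
    using that by (simp add: mult_S convolution_assoc[OF M])
  show "\<one>\<^bsub>S\<^esub> \<odot>\<^bsub>?P\<^esub> f = f" if "f \<in> carrier ?P" for f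
    using that by (simp add: one_S convolution_constant_left[OF M])
qed

text \<open>
  Write each coefficient as a combination of the generators of \<open>M\<close>; collecting the coefficients of
  one generator gives a series over \<open>R\<close>, so the generators, as constant series, span.
\<close>

lemma fg_series_module:
  assumes "fg_module R M"
  shows "fg_module S (series_module fin K M)"
proof -
  have M: "module R M" using assms by (simp add: fg_module_def)
  interpret M: module R M by (rule M)
  let ?P = "series_module fin K M"
  interpret P: module S ?P by (rule module_series_module[OF M])
  obtain A where A: "finite A" "A \<subseteq> carrier M"
    and span: "\<And>x. x \<in> carrier M \<Longrightarrow> \<exists>c\<in>A \<rightarrow> carrier R. x = (\<Oplus>\<^bsub>M\<^esub>a\<in>A. c a \<odot>\<^bsub>M\<^esub> a)"
    using assms unfolding fg_module_def by blast
  \<comment> \<open>Zero gets the zero combination: the collected series then vanish wherever the given series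
    does, hence are supported in \<open>K\<close>, and finitely if need be.\<close>
  have "\<exists>c\<in>A \<rightarrow> carrier R. x = (\<Oplus>\<^bsub>M\<^esub>a\<in>A. c a \<odot>\<^bsub>M\<^esub> a) \<and> (x = \<zero>\<^bsub>M\<^esub> \<longrightarrow> (\<forall>a. c a = \<zero>\<^bsub>R\<^esub>))"
    if x: "x \<in> carrier M" for x
  proof (cases "x = \<zero>\<^bsub>M\<^esub>")
    case True
    have "(\<Oplus>\<^bsub>M\<^esub>a\<in>A. \<zero>\<^bsub>R\<^esub> \<odot>\<^bsub>M\<^esub> a) = \<zero>\<^bsub>M\<^esub>"
      using A by (intro M.M.add.finprod_one_eqI) auto
    with True show ?thesis by (intro bexI[of _ "\<lambda>_. \<zero>\<^bsub>R\<^esub>"]) auto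
  next
    case False
    with span[OF x] show ?thesis by blast
  qed
  then have "\<forall>x\<in>carrier M. \<exists>c. c \<in> A \<rightarrow> carrier R \<and> x = (\<Oplus>\<^bsub>M\<^esub>a\<in>A. c a \<odot>\<^bsub>M\<^esub> a) \<and>
      (x = \<zero>\<^bsub>M\<^esub> \<longrightarrow> (\<forall>a. c a = \<zero>\<^bsub>R\<^esub>))" by blast
  from bchoice[OF this] obtain c where c': "\<forall>x\<in>carrier M. c x \<in> A \<rightarrow> carrier R \<and>
      x = (\<Oplus>\<^bsub>M\<^esub>a\<in>A. c x a \<odot>\<^bsub>M\<^esub> a) \<and> (x = \<zero>\<^bsub>M\<^esub> \<longrightarrow> (\<forall>a. c x a = \<zero>\<^bsub>R\<^esub>))" by blast
  have c: "c x a \<in> carrier R" if "x \<in> carrier M" "a \<in> A" for x a using c' that by blast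
  have csum: "x = (\<Oplus>\<^bsub>M\<^esub>a\<in>A. c x a \<odot>\<^bsub>M\<^esub> a)" if "x \<in> carrier M" for x using c' that by blast
  have c0: "c \<zero>\<^bsub>M\<^esub> a = \<zero>\<^bsub>R\<^esub>" for a using c' by blast
  define const where "const x = (\<lambda>m :: 'k. if m = 0 then x else \<zero>\<^bsub>M\<^esub>)" for x
  have const: "const a \<in> series fin K M" if "a \<in> A" for a
    unfolding const_def by (rule seriesI) (use that A in auto)
  have inj: "inj_on const A"
    by (rule inj_onI) (metis const_def)
  have finsum_P: "(\<Oplus>\<^bsub>?P\<^esub>a\<in>B. g a) = (\<lambda>m. \<Oplus>\<^bsub>M\<^esub>a\<in>B. g a m)"
    if "finite B" "\<And>a. a \<in> B \<Longrightarrow> g a \<in> series fin K M" for B and g :: "'d \<Rightarrow> _"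
    using that
  proof (induction B)
    case (insert a B)
    have "(\<lambda>a. g a m) \<in> B \<rightarrow> carrier M" "g a m \<in> carrier M" for m
      using seriesD(1)[OF insert.prems, of _ m] by auto
    with insert show ?case by (simp add: Pi_def)
  qed simp
  show ?thesis
    unfolding fg_module_def
  proof (intro conjI exI[of _ "const ` A"] ballI)
    show "module S ?P" by (rule P.module_axioms)
    show "finite (const ` A)" "const ` A \<subseteq> carrier ?P" using A const by auto
    fix f assume "f \<in> carrier ?P"
    then have f: "f \<in> series fin K M" by simp
    \<comment> \<open>A generator \<open>a\<close> is recovered from its constant series as the value at \<open>0\<close>.\<close>
    define r where "r b = (\<lambda>m. c (f m) (b 0))" for b :: "'k \<Rightarrow> _"
    have r: "r (const a) \<in> carrier S" if "a \<in> A" for a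
      unfolding carrier_S
    proof (rule seriesI)
      show "r (const a) m \<in> carrier R" for m
        using c that seriesD(1)[OF f] by (simp add: r_def const_def)
      show "r (const a) m = \<zero>\<^bsub>R\<^esub>" if "m \<notin> K" for m
        using that seriesD(2)[OF f] by (simp add: r_def c0)
      assume fin
      from seriesD(3)[OF f this] show "finite {m. r (const a) m \<noteq> \<zero>\<^bsub>R\<^esub>}"
        by (rule rev_finite_subset) (auto simp: r_def c0)
    qed
    have "(\<Oplus>\<^bsub>?P\<^esub>b\<in>const ` A. r b \<odot>\<^bsub>?P\<^esub> b) = (\<Oplus>\<^bsub>?P\<^esub>a\<in>A. r (const a) \<odot>\<^bsub>?P\<^esub> const a)"
      using P.smult_closed[OF r] const inj
      by (intro P.M.add.finprod_reindex) (auto simp del: series_module_simps(4))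
    also have "\<dots> = (\<lambda>m. \<Oplus>\<^bsub>M\<^esub>a\<in>A. (r (const a) \<odot>\<^bsub>?P\<^esub> const a) m)"
      using r const P.smult_closed[of "r (const _)" "const _"] A by (intro finsum_P) auto
    also have "\<dots> = f"
    proof
      fix m
      have "(\<Oplus>\<^bsub>M\<^esub>a\<in>A. (r (const a) \<odot>\<^bsub>?P\<^esub> const a) m) = (\<Oplus>\<^bsub>M\<^esub>a\<in>A. c (f m) a \<odot>\<^bsub>M\<^esub> a)"
      proof (rule M.M.finsum_cong')
        fix a assume a: "a \<in> A"
        then have "(r (const a) \<odot>\<^bsub>?P\<^esub> const a) m = r (const a) m \<odot>\<^bsub>M\<^esub> a"
          using convolution_constant_right[OF M, of "r (const a)" a] r A
          by (auto simp: const_def subset_iff)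
        then show "(r (const a) \<odot>\<^bsub>?P\<^esub> const a) m = c (f m) a \<odot>\<^bsub>M\<^esub> a"
          by (simp add: r_def const_def)
      qed (use c A seriesD(1)[OF f] in auto)
      then show "(\<Oplus>\<^bsub>M\<^esub>a\<in>A. (r (const a) \<odot>\<^bsub>?P\<^esub> const a) m) = f m"
        using csum[OF seriesD(1)[OF f, of m]] by simp
    qed
    finally show "\<exists>c\<in>const ` A \<rightarrow> carrier S. f = (\<Oplus>\<^bsub>?P\<^esub>b\<in>const ` A. c b \<odot>\<^bsub>?P\<^esub> b)"
      using r by (intro bexI[of _ r]) auto
  qed
qed

end

lemma fg_self_module:
  assumes "cring R"
  shows "fg_module R (self_module R)"
proof -
  interpret R: cring R by fact
  have "\<exists>c\<in>{\<one>\<^bsub>R\<^esub>} \<rightarrow> carrier R. x = (\<Oplus>\<^bsub>self_module R\<^esub>a\<in>{\<one>\<^bsub>R\<^esub>}. c a \<odot>\<^bsub>self_module R\<^esub> a)"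
    if "x \<in> carrier R" for x
    using that by (intro bexI[of _ "\<lambda>_. x"]) auto
  then show ?thesis
    unfolding fg_module_def using module_self_module[OF assms]
    by (intro conjI exI[of _ "{\<one>\<^bsub>R\<^esub>}"]) auto
qed

section \<open>Powers of series in prime characteristic\<close>

context series_ring
begin

lemma add_pow_S:
  fixes n :: nat
  assumes f: "f \<in> carrier S"
  shows "[n] \<cdot>\<^bsub>S\<^esub> f = (\<lambda>m. [n] \<cdot>\<^bsub>R\<^esub> f m)"
proof (induction n)
  case 0
  show ?case by (simp add: S.add.nat_pow_0 add.nat_pow_0 zero_S)
next
  case (Suc n)
  have "[n] \<cdot>\<^bsub>S\<^esub> f \<in> carrier S" using f by simp
  then have "[n] \<cdot>\<^bsub>S\<^esub> f \<oplus>\<^bsub>S\<^esub> f = (\<lambda>m. ([n] \<cdot>\<^bsub>S\<^esub> f) m \<oplus>\<^bsub>R\<^esub> f m)" using f by (rule add_S)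
  then show ?case by (simp add: Suc S.add.nat_pow_Suc add.nat_pow_Suc)
qed

lemma ring_char_S: "ring_char S = ring_char R"
proof -
  have "[n] \<cdot>\<^bsub>S\<^esub> \<one>\<^bsub>S\<^esub> = \<zero>\<^bsub>S\<^esub> \<longleftrightarrow> [n] \<cdot>\<^bsub>R\<^esub> \<one>\<^bsub>R\<^esub> = \<zero>\<^bsub>R\<^esub>" for n :: nat
    by (subst add_pow_S[OF S.one_closed]) (auto simp: one_S zero_S fun_eq_iff)
  then have "ring_char S dvd n \<longleftrightarrow> ring_char R dvd n" for n
    by (simp add: S.ring_char_dvd_iff ring_char_dvd_iff)
  then show ?thesis by (metis dvd_antisym dvd_refl)
qed

lemma finsum_S:
  assumes "finite A" "g \<in> A \<rightarrow> carrier S"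
  shows "(\<Oplus>\<^bsub>S\<^esub>i\<in>A. g i) = (\<lambda>m. \<Oplus>\<^bsub>R\<^esub>i\<in>A. g i m)"
  using assms
proof (induction A)
  case empty
  show ?case by (simp add: zero_S)
next
  case (insert i A)
  then have gi: "g i \<in> carrier S" and g: "g \<in> A \<rightarrow> carrier S" by auto
  then have "(\<lambda>i. g i m) \<in> A \<rightarrow> carrier R" for m by (auto simp: Pi_def)
  moreover have "(\<Oplus>\<^bsub>S\<^esub>i\<in>insert i A. g i) = (\<lambda>m. g i m \<oplus>\<^bsub>R\<^esub> (\<Oplus>\<^bsub>S\<^esub>i\<in>A. g i) m)"
    using insert.hyps gi g by (simp add: add_S S.finsum_closed)
  ultimately show ?case using insert.hyps gi by (simp add: insert.IH[OF g])
qed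

abbreviation monomial :: "'k \<Rightarrow> 'a \<Rightarrow> 'k \<Rightarrow> 'a" where
  "monomial i a \<equiv> (\<lambda>m. if m = i then a else \<zero>\<^bsub>R\<^esub>)"

lemma monomial_closed: "\<lbrakk>i \<in> K; a \<in> carrier R\<rbrakk> \<Longrightarrow> monomial i a \<in> carrier S"
  unfolding carrier_S by (rule seriesI) auto

lemma monomial_mult:
  assumes "i \<in> K" "j \<in> K" "a \<in> carrier R" "b \<in> carrier R"
  shows "monomial i a \<otimes>\<^bsub>S\<^esub> monomial j b = monomial (i + j) (a \<otimes>\<^bsub>R\<^esub> b)"
proof
  fix m
  have "(monomial i a \<otimes>\<^bsub>S\<^esub> monomial j b) m
      = (\<Oplus>\<^bsub>R\<^esub>x\<in>factorizations m. monomial i a (fst x) \<otimes>\<^bsub>R\<^esub> monomial j b (snd x))"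
    using assms by (simp add: mult_S monomial_closed convolution_def)
  also have "\<dots> = monomial (i + j) (a \<otimes>\<^bsub>R\<^esub> b) m"
  proof (cases "m = i + j")
    case True
    then show ?thesis using assms
      by (subst finsum_eq_single[where a = "(i, j)"]) (auto simp: mem_factorizations prod_eq_iff)
  next
    case False
    then show ?thesis using assms
      by (subst add.finprod_one_eqI) (auto simp: mem_factorizations)
  qed
  finally show "(monomial i a \<otimes>\<^bsub>S\<^esub> monomial j b) m = monomial (i + j) (a \<otimes>\<^bsub>R\<^esub> b) m" .
qed

lemma monomial_power:
  fixes n :: nat
  assumes "i \<in> K" "a \<in> carrier R"
  shows "monomial i a [^]\<^bsub>S\<^esub> n = monomial (multiple n i) (a [^]\<^bsub>R\<^esub> n)"
proof (induction n)
  case 0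
  show ?case by (auto simp: one_S)
next
  case (Suc n)
  then show ?case
    using assms monomial_mult[of "multiple n i" i "a [^]\<^bsub>R\<^esub> n" a]
    by (simp add: add.commute[of i]) (simp add: fun_eq_iff)
qed

text \<open>
  The coefficient of a power at \<open>m\<close> involves only the coefficients at summands of \<open>m\<close>. There are
  finitely many of these, so a statement on one coefficient of a power of a series reduces to
  polynomials.
\<close>

lemma power_coeff_local:
  fixes n :: nat
  assumes "f \<in> carrier S" "g \<in> carrier S"
    and "\<And>i j. i + j = m \<Longrightarrow> f i = g i" and "i + j = m"
  shows "(f [^]\<^bsub>S\<^esub> n) i = (g [^]\<^bsub>S\<^esub> n) i"
  using assms(4)
proof (induction n arbitrary: i j)
  case 0
  show ?case by simp
next
  case (Suc n)
  have "(f [^]\<^bsub>S\<^esub> n) (fst x) = (g [^]\<^bsub>S\<^esub> n) (fst x) \<and> f (snd x) = g (snd x)"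
    if "x \<in> factorizations i" for x
  proof
    have "fst x + snd x = i" using that by (simp add: mem_factorizations)
    with Suc.prems have "fst x + (snd x + j) = m" "snd x + (fst x + j) = m"
      by (auto simp: ac_simps)
    then show "(f [^]\<^bsub>S\<^esub> n) (fst x) = (g [^]\<^bsub>S\<^esub> n) (fst x)" "f (snd x) = g (snd x)"
      using Suc.IH assms(3) by blast+
  qed
  then show ?case
    using assms(1,2) by (auto simp: mult_S convolution_def intro!: finsum_cong')
qed

text \<open>
  Up to the coefficient at \<open>m\<close>, the series is a finite sum of monomials, and the Frobenius
  endomorphism raises such a sum to the \<open>p\<close>-th power term by term.
\<close>

lemma frobenius_coeff:
  assumes p: "Factorial_Ring.prime (ring_char R)" and f: "f \<in> carrier S"
  shows "k \<in> K \<Longrightarrow> (f [^]\<^bsub>S\<^esub> ring_char R) (multiple (ring_char R) k) = f k [^]\<^bsub>R\<^esub> ring_char R"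
    and "m \<notin> multiple (ring_char R) ` K \<Longrightarrow> (f [^]\<^bsub>S\<^esub> ring_char R) m = \<zero>\<^bsub>R\<^esub>"
proof -
  let ?p = "ring_char R"
  have p0: "0 < ?p" using p by (rule prime_gt_0_nat)
  have main: "(f [^]\<^bsub>S\<^esub> ?p) m
      = (\<Oplus>\<^bsub>R\<^esub>i\<in>fst ` factorizations m \<inter> K. monomial (multiple ?p i) (f i [^]\<^bsub>R\<^esub> ?p) m)" for m
  proof -
    let ?D = "fst ` factorizations m \<inter> K"
    have D: "finite ?D" by simp
    \<comment> \<open>The truncation of \<open>f\<close> to the summands of \<open>m\<close>.\<close>
    define g where "g = (\<Oplus>\<^bsub>S\<^esub>i\<in>?D. monomial i (f i))"
    have summands: "(\<lambda>i. monomial i (f i)) \<in> ?D \<rightarrow> carrier S"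
      using f by (auto intro: monomial_closed)
    have g: "g \<in> carrier S" unfolding g_def
      using summands by (rule S.finsum_closed)
    have "g i = (\<Oplus>\<^bsub>R\<^esub>j\<in>?D. monomial j (f j) i)" for i
      unfolding g_def by (simp add: finsum_S[OF D summands])
    also have "(\<Oplus>\<^bsub>R\<^esub>j\<in>?D. monomial j (f j) i) = f i" if "i + l = m" for i l
    proof (cases "i \<in> K")
      case True
      have "i = fst (i, l)" "(i, l) \<in> factorizations m" using that by (simp_all add: mem_factorizations)
      with True have "i \<in> ?D" by blast
      then show ?thesis using f by (subst finsum_eq_single[where a = i]) auto
    next
      case False
      then have "f i = \<zero>\<^bsub>R\<^esub>" using f seriesD(2)[of f fin K R] by (simp add: carrier_S)
      with False show ?thesis by (subst add.finprod_one_eqI) auto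
    qed
    finally have fg: "f i = g i" if "i + l = m" for i l using that by metis
    have "(f [^]\<^bsub>S\<^esub> ?p) m = (g [^]\<^bsub>S\<^esub> ?p) m"
      by (rule power_coeff_local[OF f g, of m m 0]) (auto intro: fg)
    also have "g [^]\<^bsub>S\<^esub> ?p = (\<Oplus>\<^bsub>S\<^esub>i\<in>?D. monomial i (f i) [^]\<^bsub>S\<^esub> ?p)"
      unfolding g_def using S.frobenius_finsum[OF _ D summands] p by (simp add: ring_char_S)
    also have "\<dots> = (\<Oplus>\<^bsub>S\<^esub>i\<in>?D. monomial (multiple ?p i) (f i [^]\<^bsub>R\<^esub> ?p))"
      using f by (intro S.finsum_cong') (auto simp: monomial_power intro: monomial_closed)
    also have "\<dots> m = (\<Oplus>\<^bsub>R\<^esub>i\<in>?D. monomial (multiple ?p i) (f i [^]\<^bsub>R\<^esub> ?p) m)"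
      using f by (subst finsum_S) (auto intro: monomial_closed)
    finally show ?thesis .
  qed
  show "(f [^]\<^bsub>S\<^esub> ?p) (multiple ?p k) = f k [^]\<^bsub>R\<^esub> ?p" if k: "k \<in> K"
  proof -
    obtain r where "?p = Suc r" using p0 by (cases ?p) auto
    then have "k + multiple r k = multiple ?p k" by simp
    then have "k = fst (k, multiple r k)" "(k, multiple r k) \<in> factorizations (multiple ?p k)"
      by (simp_all add: mem_factorizations)
    with k have "k \<in> fst ` factorizations (multiple ?p k) \<inter> K" by blast
    then show ?thesis
      unfolding main using f p0 k
      by (subst finsum_eq_single[where a = k]) (auto simp: multiple_inject)
  qed
  show "(f [^]\<^bsub>S\<^esub> ?p) m = \<zero>\<^bsub>R\<^esub>" if "m \<notin> multiple ?p ` K"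
    unfolding main using that by (subst add.finprod_one_eqI) auto
qed

lemma frobenius_power_coeff:
  assumes p: "Factorial_Ring.prime (ring_char R)" and f: "f \<in> carrier S"
  defines "q \<equiv> \<lambda>e. ring_char R ^ e"
  shows "k \<in> K \<Longrightarrow> (f [^]\<^bsub>S\<^esub> q e) (multiple (q e) k) = f k [^]\<^bsub>R\<^esub> q e"
    and "m \<notin> multiple (q e) ` K \<Longrightarrow> (f [^]\<^bsub>S\<^esub> q e) m = \<zero>\<^bsub>R\<^esub>"
proof -
  have "(\<forall>k\<in>K. (f [^]\<^bsub>S\<^esub> q e) (multiple (q e) k) = f k [^]\<^bsub>R\<^esub> q e) \<and>
      (\<forall>m. m \<notin> multiple (q e) ` K \<longrightarrow> (f [^]\<^bsub>S\<^esub> q e) m = \<zero>\<^bsub>R\<^esub>)"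
  proof (induction e)
    case 0
    have "multiple (Suc 0) ` K = K" by simp
    then show ?case using f seriesD(2)[of f fin K R] by (simp add: q_def carrier_S)
  next
    case (Suc e)
    let ?h = "f [^]\<^bsub>S\<^esub> q e"
    have h: "?h \<in> carrier S" using f by simp
    have eq: "f [^]\<^bsub>S\<^esub> q (Suc e) = ?h [^]\<^bsub>S\<^esub> ring_char R"
      using f by (simp add: S.nat_pow_pow q_def mult.commute)
    have mult: "multiple (q (Suc e)) k = multiple (ring_char R) (multiple (q e) k)" for k :: 'k
      by (simp add: multiple_multiple q_def)
    show ?case
    proof (intro conjI ballI allI impI)
      fix k assume k: "k \<in> K"
      then have "(f [^]\<^bsub>S\<^esub> q (Suc e)) (multiple (q (Suc e)) k) = (f k [^]\<^bsub>R\<^esub> q e) [^]\<^bsub>R\<^esub> ring_char R"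
        unfolding eq mult using Suc.IH by (simp add: frobenius_coeff(1)[OF p h])
      then show "(f [^]\<^bsub>S\<^esub> q (Suc e)) (multiple (q (Suc e)) k) = f k [^]\<^bsub>R\<^esub> q (Suc e)"
        using f by (simp add: nat_pow_pow q_def mult.commute)
    next
      fix m assume m: "m \<notin> multiple (q (Suc e)) ` K"
      show "(f [^]\<^bsub>S\<^esub> q (Suc e)) m = \<zero>\<^bsub>R\<^esub>"
      proof (cases "m \<in> multiple (ring_char R) ` K")
        case True
        then obtain l where l: "l \<in> K" "m = multiple (ring_char R) l" by blast
        then have "l \<notin> multiple (q e) ` K" using m by (auto simp: mult)
        then have "?h l = \<zero>\<^bsub>R\<^esub>" using Suc.IH by blast
        then show ?thesis
          using l prime_gt_0_nat[OF p] by (simp add: eq frobenius_coeff(1)[OF p h] nat_pow_zero)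
      next
        case False
        then show ?thesis by (simp add: eq frobenius_coeff(2)[OF p h])
      qed
    qed
  qed
  then show "k \<in> K \<Longrightarrow> (f [^]\<^bsub>S\<^esub> q e) (multiple (q e) k) = f k [^]\<^bsub>R\<^esub> q e"
    and "m \<notin> multiple (q e) ` K \<Longrightarrow> (f [^]\<^bsub>S\<^esub> q e) m = \<zero>\<^bsub>R\<^esub>" by blast+
qed

end

section \<open>Decomposition of the Frobenius pushforward\<close>

lemma series_frobenius_pushforward [simp]:
  "series fin K (frobenius_pushforward R e M) = series fin K M"
  by (simp add: series_def)

context series_ring
begin

text \<open>
  Apply the given isomorphism to every coefficient and sort the result by components. It commutes
  with the finite sums that define a convolution. In the other direction the support lies in the
  union of the supports of the components, which is finite for polynomials because \<open>I\<close> is finite.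
\<close>

lemma series_module_direct_sum:
  assumes N: "module R N" and I: "finite I" and M: "\<And>i. i \<in> I \<Longrightarrow> module R (M i)"
    and iso: "module_isomorphic R N (finite_direct_sum I M)"
  shows "module_isomorphic S (series_module fin K N) (finite_direct_sum I (\<lambda>i. series_module fin K (M i)))"
proof -
  interpret N: module R N by (rule N)
  obtain \<phi> \<psi> where \<phi>: "\<And>x. x \<in> carrier N \<Longrightarrow> \<phi> x \<in> (\<Pi>\<^sub>E i\<in>I. carrier (M i))"
    and \<psi>: "\<And>y. y \<in> (\<Pi>\<^sub>E i\<in>I. carrier (M i)) \<Longrightarrow> \<psi> y \<in> carrier N"
    and \<psi>\<phi>: "\<And>x. x \<in> carrier N \<Longrightarrow> \<psi> (\<phi> x) = x"
    and \<phi>\<psi>: "\<And>y. y \<in> (\<Pi>\<^sub>E i\<in>I. carrier (M i)) \<Longrightarrow> \<phi> (\<psi> y) = y"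
    and add: "\<And>x y. \<lbrakk>x \<in> carrier N; y \<in> carrier N\<rbrakk> \<Longrightarrow> \<phi> (x \<oplus>\<^bsub>N\<^esub> y) = (\<lambda>i\<in>I. \<phi> x i \<oplus>\<^bsub>M i\<^esub> \<phi> y i)"
    and smult: "\<And>r x. \<lbrakk>r \<in> carrier R; x \<in> carrier N\<rbrakk> \<Longrightarrow> \<phi> (r \<odot>\<^bsub>N\<^esub> x) = (\<lambda>i\<in>I. r \<odot>\<^bsub>M i\<^esub> \<phi> x i)"
    by (rule module_isomorphicE[OF iso, unfolded finite_direct_sum_simps]) (rule that; assumption)
  have ag: "abelian_group (M i)" if "i \<in> I" for i using M[OF that] by (simp add: module_def)
  have \<phi>i: "\<phi> x i \<in> carrier (M i)" if "x \<in> carrier N" "i \<in> I" for x i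
    using \<phi>[OF that(1)] that(2) by (simp add: PiE_iff)
  have addi: "\<phi> (x \<oplus>\<^bsub>N\<^esub> y) i = \<phi> x i \<oplus>\<^bsub>M i\<^esub> \<phi> y i"
    if "i \<in> I" "x \<in> carrier N" "y \<in> carrier N" for i x y
    using that by (simp add: add)
  note finsum = additive_finsum[OF N.M.abelian_group_axioms ag, of _ "\<lambda>x. \<phi> x _"]
  have zero: "\<phi> \<zero>\<^bsub>N\<^esub> i = \<zero>\<^bsub>M i\<^esub>" if "i \<in> I" for i
    using additive_zero[OF N.M.abelian_group_axioms ag[OF that], of "\<lambda>x. \<phi> x i"] \<phi>i addi that by blast
  have zero': "\<psi> (\<lambda>i\<in>I. \<zero>\<^bsub>M i\<^esub>) = \<zero>\<^bsub>N\<^esub>"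
  proof -
    have "\<phi> \<zero>\<^bsub>N\<^esub> = (\<lambda>i\<in>I. \<zero>\<^bsub>M i\<^esub>)"
      using \<phi>[OF N.M.zero_closed] by (auto simp: zero fun_eq_iff PiE_iff extensional_def)
    then show ?thesis using \<psi>\<phi>[OF N.M.zero_closed] by simp
  qed
  show ?thesis
  proof (rule module_isomorphicI[where f = "\<lambda>f. \<lambda>i\<in>I. \<lambda>m. \<phi> (f m) i"
        and g = "\<lambda>F m. \<psi> (\<lambda>i\<in>I. F i m)"]; simp only: finite_direct_sum_simps series_module_simps)
    fix f assume f: "f \<in> series fin K N"
    note [simp] = seriesD(1)[OF f]
    show "(\<lambda>i\<in>I. \<lambda>m. \<phi> (f m) i) \<in> (\<Pi>\<^sub>E i\<in>I. series fin K (M i))"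
    proof (rule restrict_PiE_iff[THEN iffD2], intro ballI seriesI)
      fix i assume i: "i \<in> I"
      show "\<phi> (f m) i \<in> carrier (M i)" for m using i by (simp add: \<phi>i)
      show "\<phi> (f m) i = \<zero>\<^bsub>M i\<^esub>" if "m \<notin> K" for m using seriesD(2)[OF f that] i by (simp add: zero)
      assume fin
      show "finite {m. \<phi> (f m) i \<noteq> \<zero>\<^bsub>M i\<^esub>}"
        by (rule finite_subset[OF _ seriesD(3)[OF f \<open>fin\<close>]]) (auto simp: zero i)
    qed
    have "(\<lambda>i\<in>I. (\<lambda>i\<in>I. \<lambda>m. \<phi> (f m) i) i m) = \<phi> (f m)" for m
      using \<phi>[of "f m"] by (auto simp: fun_eq_iff PiE_iff extensional_def)
    then show "(\<lambda>m. \<psi> (\<lambda>i\<in>I. (\<lambda>i\<in>I. \<lambda>m. \<phi> (f m) i) i m)) = f" by (simp add: \<psi>\<phi>)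
    show "(\<lambda>i\<in>I. \<lambda>m. \<phi> (convolution N r f m) i) = (\<lambda>i\<in>I. convolution (M i) r ((\<lambda>i\<in>I. \<lambda>m. \<phi> (f m) i) i))"
      if r: "r \<in> carrier S" for r
    proof (intro restrict_ext ext)
      fix i m assume i: "i \<in> I"
      interpret Mi: module R "M i" by (rule M[OF i])
      have "\<phi> (convolution N r f m) i
          = (\<Oplus>\<^bsub>M i\<^esub>x\<in>factorizations m. \<phi> (r (fst x) \<odot>\<^bsub>N\<^esub> f (snd x)) i)"
        unfolding convolution_def
        by (rule finsum) (use i r \<phi>i addi in \<open>auto\<close>)
      also have "\<dots> = convolution (M i) r (\<lambda>m. \<phi> (f m) i) m"
        unfolding convolution_def using r i by (intro Mi.M.finsum_cong') (auto simp: smult \<phi>i)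
      finally show "\<phi> (convolution N r f m) i = convolution (M i) r ((\<lambda>i\<in>I. \<lambda>m. \<phi> (f m) i) i) m"
        using i by simp
    qed
    show "(\<lambda>i\<in>I. \<lambda>m. \<phi> (f m \<oplus>\<^bsub>N\<^esub> g m) i)
        = (\<lambda>i\<in>I. \<lambda>m. (\<lambda>i\<in>I. \<lambda>m. \<phi> (f m) i) i m \<oplus>\<^bsub>M i\<^esub> (\<lambda>i\<in>I. \<lambda>m. \<phi> (g m) i) i m)"
      if "g \<in> series fin K N" for g
      using seriesD(1)[OF that] by (intro restrict_ext) (simp add: addi)
  next
    fix F assume F: "F \<in> (\<Pi>\<^sub>E i\<in>I. series fin K (M i))"
    then have Fi: "F i \<in> series fin K (M i)" if "i \<in> I" for i using that by (simp add: PiE_iff)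
    have Fm: "(\<lambda>i\<in>I. F i m) \<in> (\<Pi>\<^sub>E i\<in>I. carrier (M i))" for m
      using seriesD(1)[OF Fi] by simp
    show "(\<lambda>m. \<psi> (\<lambda>i\<in>I. F i m)) \<in> series fin K N"
    proof (rule seriesI)
      show "\<psi> (\<lambda>i\<in>I. F i m) \<in> carrier N" for m by (rule \<psi>[OF Fm])
      show "\<psi> (\<lambda>i\<in>I. F i m) = \<zero>\<^bsub>N\<^esub>" if "m \<notin> K" for m
        using seriesD(2)[OF Fi that] by (simp add: zero' cong: restrict_cong)
      assume fin
      have "\<psi> (\<lambda>i\<in>I. F i m) = \<zero>\<^bsub>N\<^esub>" if "\<forall>i\<in>I. F i m = \<zero>\<^bsub>M i\<^esub>" for m
        using that by (simp add: zero' cong: restrict_cong)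
      then have "{m. \<psi> (\<lambda>i\<in>I. F i m) \<noteq> \<zero>\<^bsub>N\<^esub>} \<subseteq> (\<Union>i\<in>I. {m. F i m \<noteq> \<zero>\<^bsub>M i\<^esub>})" by blast
      then show "finite {m. \<psi> (\<lambda>i\<in>I. F i m) \<noteq> \<zero>\<^bsub>N\<^esub>}"
        by (rule finite_subset) (use I seriesD(3)[OF Fi \<open>fin\<close>] in blast)
    qed
    show "(\<lambda>i\<in>I. \<lambda>m. \<phi> (\<psi> (\<lambda>i\<in>I. F i m)) i) = F"
      using F by (auto simp: \<phi>\<psi>[OF Fm] fun_eq_iff PiE_iff extensional_def)
  qed
qed

text \<open>
  A series \<open>f\<close> corresponds to the family of series \<open>k \<mapsto> f\<^bsub>b + q k\<^esub>\<close>, one for each remainder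
  \<open>b\<close>. Linearity is the point. In the coefficient of \<open>r\<^sup>q f\<close> at \<open>b + q k\<close> only the
  decompositions of \<open>b + q k\<close> into a multiple \<open>q u\<close> and some \<open>c + q v\<close> contribute, as \<open>r\<^sup>q\<close> is
  supported on multiples of \<open>q\<close>. Uniqueness of division forces \<open>c = b\<close> and \<open>u + v = k\<close>, which leaves
  the sum of the terms \<open>(r\<^sub>u)\<^sup>q f\<^bsub>b + q v\<^esub>\<close>.
\<close>

lemma frobenius_pushforward_series:
  assumes p: "Factorial_Ring.prime (ring_char R)" and B: "finite B"
    and bij: "bij_betw (\<lambda>x. fst x + multiple (ring_char R ^ e) (snd x)) (B \<times> K) K"
  shows "module_isomorphic S (frobenius_pushforward S e (self_module S))
    (finite_direct_sum B (\<lambda>_. series_module fin K (frobenius_pushforward R e (self_module R))))"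
proof -
  define q where "q = ring_char R ^ e"
  have q: "0 < q" using prime_gt_0_nat[OF p] by (simp add: q_def)
  define \<delta> where "\<delta> x = fst x + multiple q (snd x)" for x :: "'k \<times> 'k"
  have \<delta>: "bij_betw \<delta> (B \<times> K) K" using bij by (simp add: \<delta>_def[abs_def] q_def)
  define \<epsilon> where "\<epsilon> = inv_into (B \<times> K) \<delta>"
  have \<epsilon>: "\<epsilon> m \<in> B \<times> K" "fst (\<epsilon> m) + multiple q (snd (\<epsilon> m)) = m" if "m \<in> K" for m
    using bij_betw_inv_into_right[OF \<delta> that] bij_betwE[OF bij_betw_inv_into[OF \<delta>]] that
    by (auto simp: \<epsilon>_def \<delta>_def)
  have \<epsilon>\<delta>: "\<epsilon> (b + multiple q k) = (b, k)" if "b \<in> B" "k \<in> K" for b k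
    using bij_betw_inv_into_left[OF \<delta>, of "(b, k)"] that by (simp add: \<epsilon>_def \<delta>_def)
  have BK: "b \<in> K" if "b \<in> B" for b
    using bij_betwE[OF \<delta>, rule_format, of "(b, 0)"] that by (simp add: \<delta>_def add_mem_iff)
  have mem_K: "b + multiple q k \<in> K \<longleftrightarrow> k \<in> K" if "b \<in> B" for b k
    using that BK q by (simp add: add_mem_iff multiple_mem_iff)
  let ?N = "frobenius_pushforward R e (self_module R)"
  have N_simps: "carrier ?N = carrier R" "\<zero>\<^bsub>?N\<^esub> = \<zero>\<^bsub>R\<^esub>" "x \<oplus>\<^bsub>?N\<^esub> y = x \<oplus>\<^bsub>R\<^esub> y"
    "r \<odot>\<^bsub>?N\<^esub> x = (r [^]\<^bsub>R\<^esub> q) \<otimes>\<^bsub>R\<^esub> x" "finsum ?N f A = finsum R f A"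
    "series fin K ?N = carrier S" for x y r f and A :: "('k \<times> 'k) set"
    by (simp_all only: frobenius_pushforward_simps finsum_frobenius_pushforward series_frobenius_pushforward
        self_module_simps q_def carrier_S)
  have S_simps: "carrier (frobenius_pushforward S e (self_module S)) = carrier S"
    "x \<oplus>\<^bsub>frobenius_pushforward S e (self_module S)\<^esub> y = x \<oplus>\<^bsub>S\<^esub> y"
    "r \<odot>\<^bsub>frobenius_pushforward S e (self_module S)\<^esub> x = (r [^]\<^bsub>S\<^esub> q) \<otimes>\<^bsub>S\<^esub> x" for x y r
    by (simp_all only: frobenius_pushforward_simps self_module_simps q_def ring_char_S)
  have coeff: "((r [^]\<^bsub>S\<^esub> q) \<otimes>\<^bsub>S\<^esub> f) (b + multiple q k) = convolution ?N r (\<lambda>k. f (b + multiple q k)) k"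
    if r: "r \<in> carrier S" and f: "f \<in> carrier S" and b: "b \<in> B" for r f b k
  proof (cases "k \<in> K")
    case True
    let ?h = "\<lambda>y. (multiple q (fst y), b + multiple q (snd y))"
    have fact_K: "fst y \<in> K \<and> snd y \<in> K" if "y \<in> factorizations m" "m \<in> K" for y m
      using that by (auto simp: mem_factorizations add_mem_iff)
    have inj: "inj_on ?h (factorizations k)"
    proof (rule inj_onI)
      fix x y assume "x \<in> factorizations k" "y \<in> factorizations k" "?h x = ?h y"
      then show "x = y"
        using fact_K[of x k] fact_K[of y k] True q by (simp add: multiple_inject prod_eq_iff)
    qed
    have sub: "?h ` factorizations k \<subseteq> factorizations (b + multiple q k)"
      by (auto simp: mem_factorizations multiple_add ac_simps)
    \<comment> \<open>Only decompositions of \<open>b + q k\<close> that come from one of \<open>k\<close> contribute.\<close>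
    have off: "(r [^]\<^bsub>S\<^esub> q) (fst x) \<otimes>\<^bsub>R\<^esub> f (snd x) = \<zero>\<^bsub>R\<^esub>"
      if x: "x \<in> factorizations (b + multiple q k) - ?h ` factorizations k" for x
    proof (cases "fst x \<in> multiple q ` K")
      case True
      then obtain u where u: "u \<in> K" "fst x = multiple q u" by blast
      have "snd x \<in> K"
        using fact_K[of x "b + multiple q k"] x \<open>k \<in> K\<close> b by (simp add: mem_K)
      then obtain c v where v: "c \<in> B" "v \<in> K" "snd x = c + multiple q v"
        using \<epsilon>[of "snd x"] that[of "fst (\<epsilon> (snd x))" "snd (\<epsilon> (snd x))"]
        by (simp only: mem_Times_iff)
      have eq: "c + multiple q (u + v) = b + multiple q k"
        using x u v by (simp add: mem_factorizations multiple_add ac_simps)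
      have "(c, u + v) = \<epsilon> (c + multiple q (u + v))"
        by (rule \<epsilon>\<delta>[symmetric]) (use u v in \<open>simp_all add: add_mem_iff\<close>)
      also have "\<dots> = (b, k)" unfolding eq by (rule \<epsilon>\<delta>[OF b \<open>k \<in> K\<close>])
      finally have "(c, u + v) = (b, k)" .
      then have "x = ?h (u, v)" "(u, v) \<in> factorizations k"
        using u v by (simp_all add: prod_eq_iff mem_factorizations)
      then show ?thesis using x by blast
    next
      case False
      then have "(r [^]\<^bsub>S\<^esub> q) (fst x) = \<zero>\<^bsub>R\<^esub>"
        using frobenius_power_coeff(2)[OF p r, of "fst x" e] by (simp add: q_def)
      then show ?thesis using f by simp
    qed
    have rq: "r [^]\<^bsub>S\<^esub> q \<in> carrier S" using r by simp
    have "((r [^]\<^bsub>S\<^esub> q) \<otimes>\<^bsub>S\<^esub> f) (b + multiple q k)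
        = (\<Oplus>\<^bsub>R\<^esub>x\<in>factorizations (b + multiple q k). (r [^]\<^bsub>S\<^esub> q) (fst x) \<otimes>\<^bsub>R\<^esub> f (snd x))"
      using rq f by (simp add: mult_S convolution_def)
    also have "\<dots> = (\<Oplus>\<^bsub>R\<^esub>x\<in>?h ` factorizations k. (r [^]\<^bsub>S\<^esub> q) (fst x) \<otimes>\<^bsub>R\<^esub> f (snd x))"
      using sub off coeff_closed[OF rq] coeff_closed[OF f]
      by (intro add.finprod_mono_neutral_cong_right) auto
    also have "\<dots> = (\<Oplus>\<^bsub>R\<^esub>y\<in>factorizations k. (r [^]\<^bsub>S\<^esub> q) (multiple q (fst y)) \<otimes>\<^bsub>R\<^esub> f (b + multiple q (snd y)))"
      using coeff_closed[OF rq] coeff_closed[OF f] inj by (subst add.finprod_reindex) auto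
    also have "\<dots> = (\<Oplus>\<^bsub>R\<^esub>y\<in>factorizations k. (r (fst y) [^]\<^bsub>R\<^esub> q) \<otimes>\<^bsub>R\<^esub> f (b + multiple q (snd y)))"
      using fact_K[OF _ True] frobenius_power_coeff(1)[OF p r, of _ e] r f
      by (intro finsum_cong') (auto simp: q_def)
    finally show ?thesis by (simp add: convolution_def q_def)
  next
    case False
    have "(r [^]\<^bsub>S\<^esub> q) \<otimes>\<^bsub>S\<^esub> f \<in> series fin K R"
      using r f S.nat_pow_closed[of r q] S.m_closed[of "r [^]\<^bsub>S\<^esub> q" f] by (simp add: carrier_S)
    then have "((r [^]\<^bsub>S\<^esub> q) \<otimes>\<^bsub>S\<^esub> f) (b + multiple q k) = \<zero>\<^bsub>R\<^esub>"
      by (rule seriesD(2)) (simp add: mem_K b False)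
    moreover have "convolution ?N r (\<lambda>k. f (b + multiple q k)) k = \<zero>\<^bsub>?N\<^esub>"
    proof (rule convolution_eq_zero[OF module_frobenius_pushforward[OF self p]])
      fix i j assume "i + j = k"
      with False have "i \<notin> K \<or> j \<notin> K" by (auto simp: add_mem_iff)
      then show "r i = \<zero>\<^bsub>R\<^esub> \<or> f (b + multiple q j) = \<zero>\<^bsub>?N\<^esub>"
        using r f b seriesD(2)[of r fin K R i] seriesD(2)[of f fin K R "b + multiple q j"]
        by (auto simp: N_simps carrier_S mem_K)
    qed (use r f in \<open>simp_all add: N_simps\<close>)
    ultimately show ?thesis by (simp add: N_simps)
  qed
  show ?thesis
  proof (rule module_isomorphicI[where f = "\<lambda>f. \<lambda>b\<in>B. \<lambda>k. f (b + multiple q k)"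
        and g = "\<lambda>F m. if m \<in> K then F (fst (\<epsilon> m)) (snd (\<epsilon> m)) else \<zero>\<^bsub>R\<^esub>"];
      simp only: finite_direct_sum_simps series_module_simps N_simps S_simps)
    fix f assume f: "f \<in> carrier S"
    then have f': "f \<in> series fin K R" by (simp add: carrier_S)
    show "(\<lambda>b\<in>B. \<lambda>k. f (b + multiple q k)) \<in> B \<rightarrow>\<^sub>E carrier S"
      unfolding carrier_S
    proof (rule restrict_PiE_iff[THEN iffD2], intro ballI seriesI)
      fix b assume b: "b \<in> B"
      show "f (b + multiple q k) \<in> carrier R" for k using f by simp
      show vanish: "f (b + multiple q k) = \<zero>\<^bsub>R\<^esub>" if "k \<notin> K" for k
        using seriesD(2)[OF f'] that b by (simp add: mem_K)
      assume fin
      have "inj_on (\<lambda>k. b + multiple q k) {k. f (b + multiple q k) \<noteq> \<zero>\<^bsub>R\<^esub>}"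
        using vanish q by (auto simp: inj_on_def) (metis multiple_inject)
      moreover have "finite ((\<lambda>k. b + multiple q k) ` {k. f (b + multiple q k) \<noteq> \<zero>\<^bsub>R\<^esub>})"
        by (rule finite_subset[OF _ seriesD(3)[OF f' \<open>fin\<close>]]) auto
      ultimately show "finite {k. f (b + multiple q k) \<noteq> \<zero>\<^bsub>R\<^esub>}" by (rule finite_imageD[rotated])
    qed
    show "(\<lambda>m. if m \<in> K then (\<lambda>b\<in>B. \<lambda>k. f (b + multiple q k)) (fst (\<epsilon> m)) (snd (\<epsilon> m)) else \<zero>\<^bsub>R\<^esub>) = f"
    proof
      fix m
      show "(if m \<in> K then (\<lambda>b\<in>B. \<lambda>k. f (b + multiple q k)) (fst (\<epsilon> m)) (snd (\<epsilon> m)) else \<zero>\<^bsub>R\<^esub>) = f m"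
        using \<epsilon>[of m] seriesD(2)[OF f', of m] by (auto simp: mem_Times_iff)
    qed
    show "(\<lambda>b\<in>B. \<lambda>k. (f \<oplus>\<^bsub>S\<^esub> g) (b + multiple q k))
        = (\<lambda>b\<in>B. \<lambda>m. (\<lambda>b\<in>B. \<lambda>k. f (b + multiple q k)) b m \<oplus>\<^bsub>R\<^esub> (\<lambda>b\<in>B. \<lambda>k. g (b + multiple q k)) b m)"
      if "g \<in> carrier S" for g
      using f that by (intro restrict_ext) (simp add: add_S)
    show "(\<lambda>b\<in>B. \<lambda>k. ((r [^]\<^bsub>S\<^esub> q) \<otimes>\<^bsub>S\<^esub> f) (b + multiple q k))
        = (\<lambda>b\<in>B. convolution ?N r ((\<lambda>b\<in>B. \<lambda>k. f (b + multiple q k)) b))"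
      if "r \<in> carrier S" for r
      using f that by (intro restrict_ext ext) (simp add: coeff)
  next
    fix F assume F: "F \<in> B \<rightarrow>\<^sub>E carrier S"
    then have Fb: "F b \<in> series fin K R" if "b \<in> B" for b using that by (auto simp: carrier_S)
    have \<epsilon>B: "fst (\<epsilon> m) \<in> B" if "m \<in> K" for m using \<epsilon>(1)[OF that] by (simp add: mem_Times_iff)
    show "(\<lambda>m. if m \<in> K then F (fst (\<epsilon> m)) (snd (\<epsilon> m)) else \<zero>\<^bsub>R\<^esub>) \<in> carrier S"
      unfolding carrier_S
    proof (rule seriesI)
      show "(if m \<in> K then F (fst (\<epsilon> m)) (snd (\<epsilon> m)) else \<zero>\<^bsub>R\<^esub>) \<in> carrier R" for m
        using seriesD(1)[OF Fb[OF \<epsilon>B]] by simp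
      show "(if m \<in> K then F (fst (\<epsilon> m)) (snd (\<epsilon> m)) else \<zero>\<^bsub>R\<^esub>) = \<zero>\<^bsub>R\<^esub>" if "m \<notin> K" for m
        using that by simp
      assume fin
      show "finite {m. (if m \<in> K then F (fst (\<epsilon> m)) (snd (\<epsilon> m)) else \<zero>\<^bsub>R\<^esub>) \<noteq> \<zero>\<^bsub>R\<^esub>}"
      proof (rule finite_subset)
        show "finite (\<delta> ` (SIGMA b : B. {k. F b k \<noteq> \<zero>\<^bsub>R\<^esub>}))"
          using B seriesD(3)[OF Fb \<open>fin\<close>] by auto
        show "{m. (if m \<in> K then F (fst (\<epsilon> m)) (snd (\<epsilon> m)) else \<zero>\<^bsub>R\<^esub>) \<noteq> \<zero>\<^bsub>R\<^esub>}
            \<subseteq> \<delta> ` (SIGMA b : B. {k. F b k \<noteq> \<zero>\<^bsub>R\<^esub>})"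
        proof
          fix m assume "m \<in> {m. (if m \<in> K then F (fst (\<epsilon> m)) (snd (\<epsilon> m)) else \<zero>\<^bsub>R\<^esub>) \<noteq> \<zero>\<^bsub>R\<^esub>}"
          then have "m \<in> K" "F (fst (\<epsilon> m)) (snd (\<epsilon> m)) \<noteq> \<zero>\<^bsub>R\<^esub>" by (auto split: if_splits)
          then show "m \<in> \<delta> ` (SIGMA b : B. {k. F b k \<noteq> \<zero>\<^bsub>R\<^esub>})"
            using \<epsilon>[of m] by (intro image_eqI[of _ _ "\<epsilon> m"]) (auto simp: \<delta>_def mem_Sigma_iff split: prod.splits)
        qed
      qed
    qed
    have "(if b + multiple q k \<in> K then F (fst (\<epsilon> (b + multiple q k))) (snd (\<epsilon> (b + multiple q k))) else \<zero>\<^bsub>R\<^esub>) = F b k"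
      if "b \<in> B" for b k
      using that seriesD(2)[OF Fb[OF that], of k] by (simp add: mem_K \<epsilon>\<delta>)
    then show "(\<lambda>b\<in>B. \<lambda>k. if b + multiple q k \<in> K then F (fst (\<epsilon> (b + multiple q k))) (snd (\<epsilon> (b + multiple q k))) else \<zero>\<^bsub>R\<^esub>) = F"
      using F by (auto simp: fun_eq_iff PiE_iff extensional_def)
  qed
qed

end

text \<open>
  The series modules of the modules for \<open>R\<close> work for \<open>S\<close>; the multiplicities for \<open>e\<close> are those
  for \<open>R\<close> times the number of remainders modulo \<open>p\<^sup>e\<close>.
\<close>

theorem (in series_ring) FFRT_series_ring:
  assumes p: "Factorial_Ring.prime (ring_char R)" and "FFRT_ring R"
  shows "FFRT_ring S"
proof -
  obtain Ms :: "('a, (nat \<Rightarrow> 'a) set) module list" where Ms: "FFRT_by R (self_module R) Ms"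
    using assms(2) unfolding FFRT_ring_def FFRT_def by blast
  have fg: "fg_module R N" if "N \<in> set Ms" for N using Ms that by (simp add: FFRT_by_def)
  have mod: "module R N" if "N \<in> set Ms" for N using fg[OF that] by (simp add: fg_module_def)
  have "FFRT_by S (self_module S) (map (series_module fin K) Ms)"
    unfolding FFRT_by_def
  proof (intro conjI ballI allI impI)
    show "fg_module S (self_module S)" by (rule fg_self_module) (rule cring_S)
    show "fg_module S N" if "N \<in> set (map (series_module fin K) Ms)" for N
      using that by (auto intro: fg_series_module fg)
    fix e :: nat assume "0 < e"
    then obtain t :: "nat \<Rightarrow> nat" where
      t: "module_isomorphic R (frobenius_pushforward R e (self_module R))
        (finite_direct_sum {(j, k). j < length Ms \<and> k < t j} (\<lambda>(j, k). Ms ! j))"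
      using Ms unfolding FFRT_by_def by blast
    let ?I = "{(j, k). j < length Ms \<and> k < t j}"
    let ?F = "frobenius_pushforward R e (self_module R)"
    let ?M = "\<lambda>(j, k). series_module fin K (Ms ! j)"
    have F: "module R ?F" by (rule module_frobenius_pushforward[OF self p])
    have "?I = (SIGMA j : {..<length Ms}. {..<t j})" by auto
    then have I: "finite ?I" by simp
    have "0 < ring_char R ^ e" using prime_gt_0_nat[OF p] by simp
    from division[OF this] obtain B where B: "finite B"
      "bij_betw (\<lambda>x. fst x + multiple (ring_char R ^ e) (snd x)) (B \<times> K) K"
      by blast
    obtain h where h: "bij_betw h {(j, k). j < length Ms \<and> k < card B * t j} (B \<times> ?I)"
      "\<And>x. fst (snd (h x)) = fst x"
      using bij_betw_copies[OF B(1)] by blast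
    have M: "module R (case i of (j, k) \<Rightarrow> Ms ! j)" if "i \<in> ?I" for i using that mod by auto
    have "module_isomorphic S (frobenius_pushforward S e (self_module S))
        (finite_direct_sum B (\<lambda>_. series_module fin K ?F))"
      by (rule frobenius_pushforward_series[OF p B])
    moreover have "module_isomorphic S (finite_direct_sum B (\<lambda>_. series_module fin K ?F))
        (finite_direct_sum B (\<lambda>_. finite_direct_sum ?I ?M))"
    proof (rule finite_direct_sum_cong_iso)
      have iso: "module_isomorphic S (series_module fin K ?F)
          (finite_direct_sum ?I (\<lambda>i. series_module fin K (case i of (j, k) \<Rightarrow> Ms ! j)))"
        by (rule series_module_direct_sum[OF F I M t])
      then show "module_isomorphic S (series_module fin K ?F) (finite_direct_sum ?I ?M)"
        by (simp add: case_prod_beta')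
      show "module S (series_module fin K ?F)" by (rule module_series_module[OF F])
      show "module S (finite_direct_sum ?I ?M)"
        by (rule module_finite_direct_sum[OF cring_S])
          (use mod in \<open>auto intro!: module_series_module\<close>)
    qed
    moreover have "module_isomorphic S (finite_direct_sum B (\<lambda>_. finite_direct_sum ?I ?M))
        (finite_direct_sum {(j, k). j < length Ms \<and> k < card B * t j} (\<lambda>x. ?M (snd (h x))))"
      by (rule finite_direct_sum_nested[OF h(1)])
    moreover have "finite_direct_sum {(j, k). j < length Ms \<and> k < card B * t j} (\<lambda>x. ?M (snd (h x)))
        = finite_direct_sum {(j, k). j < length Ms \<and> k < card B * t j}
            (\<lambda>(j, k). map (series_module fin K) Ms ! j)"
      by (rule finite_direct_sum_cong) (auto simp: case_prod_beta' h(2))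
    ultimately have "module_isomorphic S (frobenius_pushforward S e (self_module S))
        (finite_direct_sum {(j, k). j < length Ms \<and> k < card B * t j}
          (\<lambda>(j, k). map (series_module fin K) Ms ! j))"
      by (simp only:) (rule module_isomorphic_trans, assumption, rule module_isomorphic_trans, assumption+)
    then show "\<exists>t :: nat \<Rightarrow> nat. module_isomorphic S (frobenius_pushforward S e (self_module S))
        (finite_direct_sum {(j, k). j < length (map (series_module fin K) Ms) \<and> k < t j}
          (\<lambda>(j, k). map (series_module fin K) Ms ! j))"
      unfolding length_map by (rule exI[of _ "\<lambda>j. card B * t j"])
  qed
  then show ?thesis unfolding FFRT_ring_def by (rule FFRT_by_imp_FFRT)
qed

section \<open>Polynomials and power series in one and several variables\<close>

lemma multiple_nat: "multiple q (k :: nat) = q * k"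
  by (induction q) simp_all

lemma factorizations_nat: "factorizations (n :: nat) = (\<lambda>i. (i, n - i)) ` {..n}"
  by (force simp: factorizations_def)

lemma monomials_nat: "monomials (UNIV :: nat set)"
proof
  fix q :: nat assume "0 < q"
  then have "bij_betw (\<lambda>x. fst x + multiple q (snd x)) ({..<q} \<times> UNIV) (UNIV :: nat set)"
    by (intro bij_betw_byWitness[where f' = "\<lambda>m. (m mod q, m div q)"]) (auto simp: multiple_nat)
  then show "\<exists>B :: nat set. finite B \<and> bij_betw (\<lambda>x. fst x + multiple q (snd x)) (B \<times> UNIV) UNIV"
    by blast
qed (auto simp: factorizations_nat)

lemma multiple_multiset: "multiple q k = repeat_mset q k"
  by (induction q) (simp_all add: multiset_eq_iff)

lemma factorizations_multiset: "factorizations m = (\<lambda>k. (k, m - k)) ` {k. k \<subseteq># m}"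
  by (force simp: factorizations_def image_iff subset_mset.add_diff_inverse)

lemma finite_submultisets: "finite {k. k \<subseteq># m}"
proof (induction m)
  case (add x m)
  have "k \<in> {k. k \<subseteq># m} \<union> add_mset x ` {k. k \<subseteq># m}" if "k \<subseteq># add_mset x m" for k
  proof (cases "x \<in># k")
    case True
    then obtain l where "k = add_mset x l" by (metis mset_add)
    then show ?thesis using that by simp
  next
    case False
    then have "count k y \<le> count m y" for y
      using mset_subset_eq_count[OF that, of y] by (cases "y = x") (auto simp: not_in_iff)
    then show ?thesis by (auto intro: mset_subset_eqI)
  qed
  then have "{k. k \<subseteq># add_mset x m} \<subseteq> {k. k \<subseteq># m} \<union> add_mset x ` {k. k \<subseteq># m}" by blast
  then show ?case by (rule finite_subset) (use add in simp)
qed simp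

text \<open>
  Division with remainder by \<open>q\<close> is done in each multiplicity separately. The remainders are bounded
  by the multiset that contains every variable \<open>q\<close> times, so finitely many suffice.
\<close>

lemma monomials_multiset:
  assumes "finite I"
  shows "monomials {m. set_mset m \<subseteq> I}"
proof
  fix q :: nat assume q: "0 < q"
  let ?K = "{m. set_mset m \<subseteq> I}"
  define rem quo where "rem m = Abs_multiset (\<lambda>i. count m i mod q)"
    and "quo m = Abs_multiset (\<lambda>i. count m i div q)" for m :: "'a multiset"
  have fin: "finite {i. 0 < count m i mod q}" "finite {i. 0 < count m i div q}" for m :: "'a multiset"
    by (rule finite_subset[OF _ finite_set_mset[of m]]; auto simp flip: count_greater_zero_iff intro: ccontr)+
  have [simp]: "count (rem m) i = count m i mod q" "count (quo m) i = count m i div q" for m i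
    unfolding rem_def quo_def by (simp_all add: count_Abs_multiset fin)
  define B where "B = {b \<in> ?K. \<forall>i. count b i < q}"
  have "b \<subseteq># repeat_mset q (mset_set I)" if "b \<in> B" for b
  proof (rule mset_subset_eqI)
    fix i
    show "count b i \<le> count (repeat_mset q (mset_set I)) i"
      using that assms by (cases "i \<in> I") (auto simp: B_def less_imp_le count_eq_zero_iff)
  qed
  then have "B \<subseteq> {k. k \<subseteq># repeat_mset q (mset_set I)}" by blast
  then have "finite B" by (rule finite_subset) (rule finite_submultisets)
  moreover have "bij_betw (\<lambda>x. fst x + multiple q (snd x)) (B \<times> ?K) ?K"
  proof (rule bij_betw_byWitness[where f' = "\<lambda>m. (rem m, quo m)"])
    show "\<forall>x\<in>B \<times> ?K. (rem (fst x + multiple q (snd x)), quo (fst x + multiple q (snd x))) = x"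
      using q by (auto simp: B_def multiple_multiset multiset_eq_iff)
    show "\<forall>m\<in>?K. fst (rem m, quo m) + multiple q (snd (rem m, quo m)) = m"
      by (auto simp: multiple_multiset multiset_eq_iff)
    show "(\<lambda>x. fst x + multiple q (snd x)) ` (B \<times> ?K) \<subseteq> ?K"
    proof -
      have "set_mset (repeat_mset q k) \<subseteq> set_mset k" for k :: "'a multiset"
        by (auto simp flip: count_greater_zero_iff)
      then show ?thesis by (fastforce simp: B_def multiple_multiset)
    qed
    show "(\<lambda>m. (rem m, quo m)) ` ?K \<subseteq> B \<times> ?K"
    proof clarsimp
      fix m assume "set_mset m \<subseteq> I"
      moreover have "set_mset (rem m) \<subseteq> set_mset m" "set_mset (quo m) \<subseteq> set_mset m"
        by (auto simp flip: count_greater_zero_iff intro: ccontr)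
      ultimately show "rem m \<in> B \<and> set_mset (quo m) \<subseteq> I" using q by (auto simp: B_def)
    qed
  qed
  ultimately show "\<exists>B. finite B \<and> bij_betw (\<lambda>x. fst x + multiple q (snd x)) (B \<times> ?K) ?K"
    by blast
next
  show "finite (factorizations m)" for m :: "'a multiset"
    by (simp add: factorizations_multiset finite_submultisets)
qed auto

lemma convolution_self_module:
  assumes "cring R" and "factorizations m = (\<lambda>i. (i, h i)) ` A"
    and "\<And>i. f i \<in> carrier R" "\<And>i. g i \<in> carrier R"
  shows "convolution (self_module R) f g m = (\<Oplus>\<^bsub>R\<^esub>i\<in>A. f i \<otimes>\<^bsub>R\<^esub> g (h i))"
proof -
  interpret cring R by fact
  show ?thesis
    unfolding convolution_def assms(2) using assms(3,4)
    by (simp, subst add.finprod_reindex) (auto simp: inj_on_def)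
qed

lemma series_ring_UP:
  assumes "cring R"
  shows "series_ring (UNIV :: nat set) R True (UP R)"
proof (intro series_ring.intro monomials_nat series_ring_axioms.intro assms)
  have "(\<exists>n. bound \<zero>\<^bsub>R\<^esub> n f) \<longleftrightarrow> finite {m. f m \<noteq> \<zero>\<^bsub>R\<^esub>}" for f :: "nat \<Rightarrow> 'a"
    unfolding bound_def finite_nat_set_iff_bounded_le by (auto simp: not_le[symmetric])
  then show carrier: "carrier (UP R) = series True UNIV R"
    by (auto simp: UP_def up_def series_def)
  fix f g assume fg: "f \<in> carrier (UP R)" "g \<in> carrier (UP R)"
  then show "f \<oplus>\<^bsub>UP R\<^esub> g = (\<lambda>m. f m \<oplus>\<^bsub>R\<^esub> g m)" by (simp add: UP_def)
  have "f i \<in> carrier R" "g i \<in> carrier R" for i using fg unfolding carrier by (auto dest: seriesD(1))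
  then have "convolution (self_module R) f g = (\<lambda>n. \<Oplus>\<^bsub>R\<^esub>i\<in>{..n}. f i \<otimes>\<^bsub>R\<^esub> g (n - i))"
    by (intro ext convolution_self_module assms factorizations_nat)
  then show "f \<otimes>\<^bsub>UP R\<^esub> g = convolution (self_module R) f g" using fg by (simp add: UP_def)
qed (simp_all add: UP_def)

lemma series_ring_power_series_ring:
  assumes "cring R"
  shows "series_ring (UNIV :: nat set) R False (power_series_ring R)"
proof (intro series_ring.intro monomials_nat series_ring_axioms.intro assms)
  show "carrier (power_series_ring R) = series False UNIV R"
    by (auto simp: power_series_ring_def series_def)
  fix f g assume "f \<in> carrier (power_series_ring R)" "g \<in> carrier (power_series_ring R)"
  then have "f i \<in> carrier R" "g i \<in> carrier R" for i by (auto simp: power_series_ring_def)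
  then have "convolution (self_module R) f g = (\<lambda>n. \<Oplus>\<^bsub>R\<^esub>i\<in>{..n}. f i \<otimes>\<^bsub>R\<^esub> g (n - i))"
    by (intro ext convolution_self_module assms factorizations_nat)
  then show "f \<otimes>\<^bsub>power_series_ring R\<^esub> g = convolution (self_module R) f g"
    by (simp add: power_series_ring_def)
qed (simp_all add: power_series_ring_def)

lemma series_ring_mv_power_series_ring:
  assumes "cring R" and "finite I"
  shows "series_ring {m. set_mset m \<subseteq> I} R False (mv_power_series_ring I R)"
proof (intro series_ring.intro monomials_multiset series_ring_axioms.intro assms)
  show "carrier (mv_power_series_ring I R) = series False {m. set_mset m \<subseteq> I} R"
    by (auto simp: mv_power_series_ring_def series_def)
  fix f g assume "f \<in> carrier (mv_power_series_ring I R)" "g \<in> carrier (mv_power_series_ring I R)"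
  then have "f i \<in> carrier R" "g i \<in> carrier R" for i by (auto simp: mv_power_series_ring_def)
  then have "convolution (self_module R) f g = (\<lambda>m. \<Oplus>\<^bsub>R\<^esub>k\<in>{k. k \<subseteq># m}. f k \<otimes>\<^bsub>R\<^esub> g (m - k))"
    by (intro ext convolution_self_module assms factorizations_multiset)
  then show "f \<otimes>\<^bsub>mv_power_series_ring I R\<^esub> g = convolution (self_module R) f g"
    by (simp add: mv_power_series_ring_def)
qed (simp_all add: mv_power_series_ring_def)

lemma series_ring_mv_poly_ring:
  assumes "cring R" and "finite I"
  shows "series_ring {m. set_mset m \<subseteq> I} R True (mv_poly_ring I R)"
proof -
  interpret P: series_ring "{m. set_mset m \<subseteq> I}" R False "mv_power_series_ring I R"
    by (rule series_ring_mv_power_series_ring[OF assms])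
  show ?thesis
  proof (intro series_ring.intro monomials_multiset series_ring_axioms.intro assms)
    show "carrier (mv_poly_ring I R) = series True {m. set_mset m \<subseteq> I} R"
      by (auto simp: mv_poly_ring_def P.carrier_S series_def simp del: P.coeff_closed)
    fix f g assume "f \<in> carrier (mv_poly_ring I R)" "g \<in> carrier (mv_poly_ring I R)"
    then show "f \<oplus>\<^bsub>mv_poly_ring I R\<^esub> g = (\<lambda>m. f m \<oplus>\<^bsub>R\<^esub> g m)"
      "f \<otimes>\<^bsub>mv_poly_ring I R\<^esub> g = convolution (self_module R) f g"
      using P.add_S[of f g] P.mult_S[of f g] by (simp_all add: mv_poly_ring_def)
  qed (simp_all add: mv_poly_ring_def P.zero_S P.one_S)
qed

theorem theorem4p6:
  fixes R :: "('a, 'm) ring_scheme" and p n :: nat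
  assumes "cring R" and "noetherian_ring R"
    and "Factorial_Ring.prime p" and "ring_char R = p"
    and "FFRT_ring R"
  shows "FFRT_ring (UP R)
    \<and> FFRT_ring (power_series_ring R)
    \<and> FFRT_ring (mv_poly_ring {1..n} R)
    \<and> FFRT_ring (mv_power_series_ring {1..n} R)"
proof -
  have p: "Factorial_Ring.prime (ring_char R)" using assms(3,4) by simp
  note ffrt = series_ring.FFRT_series_ring[OF _ p assms(5)]
  show ?thesis
    using assms(1)
    by (intro conjI ffrt[OF series_ring_UP] ffrt[OF series_ring_power_series_ring]
        ffrt[OF series_ring_mv_poly_ring] ffrt[OF series_ring_mv_power_series_ring] finite_atLeastAtMost)
qed

end
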